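(* Let $V$ be any Euclidean Jordan algebra of rank $n$ with symmetric cone $V_+$, unit element $e$, and eigenvalue map $\lambda:V\to\mathbb{R}^n$. Let $Q$ be a permutation invariant proper polyhedral cone in $\mathbb{R}^n$ that is reducible, and let $Q=A(\mathbb{R}^n_+)$, where $A=(a-b)I+bE$ with $a,b\in\mathbb{R}$, $a\ne b$, $a\ne(1-n)b$. Then the spectral cone $\lambda^{-1}(Q)$ is isomorphic to $V_+$. In fact, $$\lambda^{-1}(Q)=L_{(a,b)}(V_+),$$ where $L_{(a,b)}:V\to V$, $L_{(a,b)}(x):=(a-b)x+b\,\operatorname{tr}(x)\,e$, is an isomorphism (invertible linear transformation) of $V$.
   Context: $I$ is the $n\times n$ identity matrix, $E$ is the $n\times n$ matrix all of whose entries are $1$, and $\mathbb{R}^n_+$ is the nonnegative orthant. (Every reducible permutation invariant pointed convex cone $Q$ in $\mathbb{R}^n$ has the form $Q=A(\mathbb{R}^n_+)$ with $A$ as in the claim.) For a Euclidean Jordan algebra $V$ of rank $n$, the eigenvalue map $\lambda:V\to\mathbb{R}^n$ takes $x\in V$ to the vector of its $n$ eigenvalues (counted with multiplicity, from its spectral decomposition with respect to a Jordan frame), written in decreasing order. The trace $\operatorname{tr}(x)$ is the sum of all eigenvalues of $x$. The symmetric cone $V_+$ is the cone of squares in $V$; equivalently $V_+=\lambda^{-1}(\mathbb{R}^n_+)$. For a permutation invariant cone $Q\subseteq\mathbb{R}^n$, the spectral cone induced by $Q$ is $\lambda^{-1}(Q)=\{x\in V:\lambda(x)\in Q\}$. A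 nonempty set $K$ in a finite dimensional real Hilbert space is a convex cone if $tx+sy\in K$ for all $x,y\in K$ and $t,s\ge0$. It is pointed if $K\cap(-K)=\{0\}$, and proper if it is closed, pointed and has nonempty interior. A closed convex cone is polyhedral if it is finitely generated. A convex cone $Q$ in $\mathbb{R}^n$ is permutation invariant if $\sigma(Q)=Q$ for every $n\times n$ permutation matrix $\sigma$. A convex cone $K$ in a space $W$ is reducible if there exist nonempty nonzero sets $K_1,K_2\subseteq W$ (that is, neither is empty and neither equals $\{0\}$) with $K=K_1+K_2$ and $\operatorname{span}(K_1)\cap\operatorname{span}(K_2)=\{0\}$. Two convex cones are isomorphic if one can be mapped onto the other by an invertible linear transformation. *)

theory Defs
  imports "HOL-Analysis.Analysis"
begin

section \<open>Euclidean Jordan algebras\<close>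

text \<open>The space is a type of class \<^class>\<open>euclidean_space\<close>, whose inner product plays the role of
  the (arbitrary) inner product of the algebra; the Jordan product and the unit are parameters.\<close>

locale euclidean_jordan_algebra =
  fixes jp :: "'v::euclidean_space \<Rightarrow> 'v \<Rightarrow> 'v"  (infixl "\<odot>" 70)
    and e :: 'v
  assumes bilinear_jp: "bilinear jp"
    and commute: "x \<odot> y = y \<odot> x"
    and jordan_identity: "x \<odot> ((x \<odot> x) \<odot> y) = (x \<odot> x) \<odot> (x \<odot> y)"
    and inner_assoc: "(x \<odot> y) \<bullet> z = y \<bullet> (x \<odot> z)"
    and unit: "e \<odot> x = x"

primrec jpower :: "('v \<Rightarrow> 'v \<Rightarrow> 'v) \<Rightarrow> 'v \<Rightarrow> 'v \<Rightarrow> nat \<Rightarrow> 'v" where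
  "jpower jp e x 0 = e"
| "jpower jp e x (Suc k) = jp x (jpower jp e x k)"

text \<open>The degree of the minimal polynomial of \<open>x\<close>: the least \<open>k\<close> for which some monic polynomial
  of degree \<open>k\<close> annihilates \<open>x\<close>.\<close>

definition jdegree :: "('v::euclidean_space \<Rightarrow> 'v \<Rightarrow> 'v) \<Rightarrow> 'v \<Rightarrow> 'v \<Rightarrow> nat" where
  "jdegree jp e x = (LEAST k. jpower jp e x k \<in> span (jpower jp e x ` {..<k}))"

definition jrank :: "('v::euclidean_space \<Rightarrow> 'v \<Rightarrow> 'v) \<Rightarrow> 'v \<Rightarrow> nat" where
  "jrank jp e = Max (range (jdegree jp e))"

definition idempotent :: "('v \<Rightarrow> 'v \<Rightarrow> 'v) \<Rightarrow> 'v \<Rightarrow> bool" where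
  "idempotent jp c \<longleftrightarrow> jp c c = c"

definition primitive_idempotent :: "('v::euclidean_space \<Rightarrow> 'v \<Rightarrow> 'v) \<Rightarrow> 'v \<Rightarrow> bool" where
  "primitive_idempotent jp c \<longleftrightarrow> idempotent jp c \<and> c \<noteq> 0 \<and>
     (\<nexists>c1 c2. idempotent jp c1 \<and> idempotent jp c2 \<and> c1 \<noteq> 0 \<and> c2 \<noteq> 0 \<and> c = c1 + c2)"

definition jordan_frame ::
    "('v::euclidean_space \<Rightarrow> 'v \<Rightarrow> 'v) \<Rightarrow> 'v \<Rightarrow> ('n::finite \<Rightarrow> 'v) \<Rightarrow> bool" where
  "jordan_frame jp e c \<longleftrightarrow>
     (\<forall>i. primitive_idempotent jp (c i)) \<and>
     (\<forall>i j. i \<noteq> j \<longrightarrow> jp (c i) (c j) = 0) \<and>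
     (\<Sum>i\<in>UNIV. c i) = e"

text \<open>The linear order on the index type \<open>'n\<close> gives meaning to ``decreasing order''. The definition
  is meaningful when \<open>CARD('n)\<close> is the rank: then the spectral theorem provides exactly one such
  vector for every \<open>x\<close>.\<close>

definition eigenvalue_map ::
    "('v::euclidean_space \<Rightarrow> 'v \<Rightarrow> 'v) \<Rightarrow> 'v \<Rightarrow> 'v \<Rightarrow> real ^ 'n::{finite,linorder}" where
  "eigenvalue_map jp e x =
     (THE v. antimono (\<lambda>i. v $ i) \<and>
        (\<exists>c. jordan_frame jp e c \<and> x = (\<Sum>i\<in>UNIV. (v $ i) *\<^sub>R c i)))"

text \<open>The \<open>itself\<close> argument only fixes the index type of the eigenvalue vector.\<close>

definition jtrace ::
    "'n::{finite,linorder} itself \<Rightarrow> ('v::euclidean_space \<Rightarrow> 'v \<Rightarrow> 'v) \<Rightarrow> 'v \<Rightarrow> 'v \<Rightarrow> real" where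
  "jtrace _ jp e x = (\<Sum>i\<in>UNIV. (eigenvalue_map jp e x :: (real, 'n) vec) $ i)"

definition symmetric_cone :: "('v \<Rightarrow> 'v \<Rightarrow> 'v) \<Rightarrow> 'v set" where
  "symmetric_cone jp = {jp x x | x. True}"

definition spectral_cone ::
    "('v::euclidean_space \<Rightarrow> 'v \<Rightarrow> 'v) \<Rightarrow> 'v \<Rightarrow> (real ^ 'n::{finite,linorder}) set \<Rightarrow> 'v set" where
  "spectral_cone jp e Q = {x. eigenvalue_map jp e x \<in> Q}"


section \<open>Cones\<close>

definition pointed_cone :: "'a::real_vector set \<Rightarrow> bool" where
  "pointed_cone K \<longleftrightarrow> convex_cone K \<and> K \<inter> uminus ` K = {0}"

definition proper_cone :: "'a::euclidean_space set \<Rightarrow> bool" where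
  "proper_cone K \<longleftrightarrow> pointed_cone K \<and> closed K \<and> interior K \<noteq> {}"

definition polyhedral_cone :: "'a::euclidean_space set \<Rightarrow> bool" where
  "polyhedral_cone K \<longleftrightarrow> closed K \<and> (\<exists>S. finite S \<and> K = convex_cone hull S)"

definition reducible_cone :: "'a::real_vector set \<Rightarrow> bool" where
  "reducible_cone K \<longleftrightarrow> convex_cone K \<and>
     (\<exists>K1 K2. K1 \<noteq> {} \<and> K1 \<noteq> {0} \<and> K2 \<noteq> {} \<and> K2 \<noteq> {0} \<and>
        K = {x + y | x y. x \<in> K1 \<and> y \<in> K2} \<and> span K1 \<inter> span K2 = {0})"

definition isomorphic_cones :: "'a::real_vector set \<Rightarrow> 'b::real_vector set \<Rightarrow> bool" where
  "isomorphic_cones K K' \<longleftrightarrow> (\<exists>f. linear f \<and> bij f \<and> f ` K = K')"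

definition permutation_matrix :: "real ^ 'n ^ 'n::finite \<Rightarrow> bool" where
  "permutation_matrix P \<longleftrightarrow> (\<exists>p. bij p \<and> P = (\<chi> i j. if j = p i then 1 else 0))"

definition permutation_invariant :: "(real ^ 'n::finite) set \<Rightarrow> bool" where
  "permutation_invariant Q \<longleftrightarrow> (\<forall>P. permutation_matrix P \<longrightarrow> (\<lambda>x. P *v x) ` Q = Q)"

definition nonneg_orthant :: "(real ^ 'n::finite) set" where
  "nonneg_orthant = {x. \<forall>i. 0 \<le> x $ i}"

definition all_ones :: "real ^ 'n ^ 'n::finite" where
  "all_ones = (\<chi> i j. 1)"

end

theory Submission
  imports Defs "HOL-Computational_Algebra.Fundamental_Theorem_Algebra"
begin

text \<open>In a Jordan frame that diagonalises \<open>x\<close>, the map \<open>L\<close> acts on the vector of eigenvalues as the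
  matrix \<open>A\<close>, so the cone identity reduces to the spectral theorem and to the linearity of the
  trace. For the latter, the point is that two primitive idempotents which are not orthogonal have
  the same norm. Hence, for any frame \<open>c\<^sub>1, \<dots>, c\<^sub>k\<close>, the linear functional
  \<open>x \<mapsto> \<Sum>\<^sub>i \<langle>x, c\<^sub>i\<rangle> / \<langle>c\<^sub>i, c\<^sub>i\<rangle>\<close> is \<open>1\<close> at every primitive idempotent, and so it is the trace.
  It follows that all frames have the same cardinality, which is the rank, and, by evaluation at
  polynomials in \<open>x\<close>, that the eigenvalues of \<open>x\<close> do not depend on the frame. No conjugacy of frames
  and no generic minimal polynomial is needed.\<close>

section \<open>Idempotents and powers\<close>

context euclidean_jordan_algebra
begin

lemma jp_add_left: "(x + y) \<odot> z = x \<odot> z + y \<odot> z"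
  and jp_add_right: "x \<odot> (y + z) = x \<odot> y + x \<odot> z"
  and jp_diff_left: "(x - y) \<odot> z = x \<odot> z - y \<odot> z"
  and jp_diff_right: "x \<odot> (y - z) = x \<odot> y - x \<odot> z"
  and jp_scaleR_left: "(r *\<^sub>R x) \<odot> y = r *\<^sub>R (x \<odot> y)"
  and jp_scaleR_right: "x \<odot> (r *\<^sub>R y) = r *\<^sub>R (x \<odot> y)"
  and jp_zero_left: "0 \<odot> x = 0"
  and jp_zero_right: "x \<odot> 0 = 0"
  using bilinear_jp
  by (auto simp: bilinear_ladd bilinear_radd bilinear_lsub bilinear_rsub bilinear_lmul
      bilinear_rmul bilinear_lzero bilinear_rzero)

lemmas jp_simps = jp_add_left jp_add_right jp_diff_left jp_diff_right jp_scaleR_left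
  jp_scaleR_right jp_zero_left jp_zero_right

lemma jp_sum_left: "sum f S \<odot> y = (\<Sum>i\<in>S. f i \<odot> y)"
  by (induction S rule: infinite_finite_induct) (auto simp: jp_simps)

lemma jp_sum_right: "y \<odot> sum f S = (\<Sum>i\<in>S. y \<odot> f i)"
  by (induction S rule: infinite_finite_induct) (auto simp: jp_simps)

lemma unit_right: "x \<odot> e = x"
  using unit commute by metis

lemma inner_unit: "e \<bullet> (x \<odot> y) = x \<bullet> y"
  by (metis commute inner_assoc unit)

text \<open>The difference of the Jordan identities at \<open>x + z\<close> and \<open>x - z\<close>
  keeps the terms of odd degree in \<open>z\<close>. The cubic ones cancel by the identity at
  \<open>z\<close>, and twice the linear part remains.\<close>

lemma jordan_identity_linear:
  "z \<odot> ((x \<odot> x) \<odot> y) + 2 *\<^sub>R (x \<odot> ((x \<odot> z) \<odot> y)) =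
   (x \<odot> x) \<odot> (z \<odot> y) + 2 *\<^sub>R ((x \<odot> z) \<odot> (x \<odot> y))"
proof -
  let ?D = "z \<odot> ((x \<odot> x) \<odot> y) + 2 *\<^sub>R (x \<odot> ((x \<odot> z) \<odot> y)) -
     ((x \<odot> x) \<odot> (z \<odot> y) + 2 *\<^sub>R ((x \<odot> z) \<odot> (x \<odot> y)))"
  have zx: "z \<odot> x = x \<odot> z" by (rule commute)
  have plus: "(x + z) \<odot> (((x + z) \<odot> (x + z)) \<odot> y) - ((x + z) \<odot> (x + z)) \<odot> ((x + z) \<odot> y) = 0"
    and minus: "(x - z) \<odot> (((x - z) \<odot> (x - z)) \<odot> y) - ((x - z) \<odot> (x - z)) \<odot> ((x - z) \<odot> y) = 0"
    by (simp_all add: jordan_identity)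
  have "2 *\<^sub>R ?D =
     ((x + z) \<odot> (((x + z) \<odot> (x + z)) \<odot> y) - ((x + z) \<odot> (x + z)) \<odot> ((x + z) \<odot> y)) -
     ((x - z) \<odot> (((x - z) \<odot> (x - z)) \<odot> y) - ((x - z) \<odot> (x - z)) \<odot> ((x - z) \<odot> y))"
    using jordan_identity[of z y]
    by (simp add: jp_simps zx scaleR_2 algebra_simps)
  then have "2 *\<^sub>R ?D = 0" unfolding plus minus by simp
  then show ?thesis by simp
qed

section \<open>Powers of an element and multiplication by them\<close>

abbreviation power_of :: "'v \<Rightarrow> nat \<Rightarrow> 'v" where
  "power_of x k \<equiv> jpower (\<odot>) e x k"

lemma square_jp_power: "(x \<odot> x) \<odot> power_of x n = power_of x (Suc (Suc n))"
proof (induction n)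
  case 0
  then show ?case by (simp add: unit_right)
next
  case (Suc n)
  then show ?case by (simp add: jordan_identity[symmetric])
qed

text \<open>The linearised identity, with \<open>power_of x m\<close> as its third argument,
  expresses multiplication by \<open>power_of x (m + 2)\<close> through multiplication by
  \<open>x\<close>, \<open>x \<odot> x\<close> and the two preceding powers. By induction and the
  Jordan identity, each of these commutes with multiplication by \<open>x\<close>.\<close>

lemma power_commutes: "power_of x n \<odot> (x \<odot> z) = x \<odot> (power_of x n \<odot> z)"
proof (induction n arbitrary: z rule: less_induct)
  case (less n)
  show ?case
  proof (cases n)
    case 0
    then show ?thesis by (simp add: unit)
  next
    case (Suc n')
    show ?thesis
    proof (cases n')
      case 0
      then show ?thesis using Suc by (simp add: unit_right)
    next
      case (Suc m)
      then have n: "n = Suc (Suc m)" using \<open>n = Suc n'\<close> by simp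
      have m: "power_of x m \<odot> (x \<odot> w) = x \<odot> (power_of x m \<odot> w)" for w
        using less n by simp
      have Sm: "power_of x (Suc m) \<odot> (x \<odot> w) = x \<odot> (power_of x (Suc m) \<odot> w)" for w
        using less(1)[of "Suc m"] n by blast
      have expand: "power_of x n \<odot> w = (x \<odot> x) \<odot> (power_of x m \<odot> w)
          + 2 *\<^sub>R (power_of x (Suc m) \<odot> (x \<odot> w)) - 2 *\<^sub>R (x \<odot> (power_of x m \<odot> (x \<odot> w)))" for w
      proof -
        have "w \<odot> power_of x n + 2 *\<^sub>R (x \<odot> ((x \<odot> w) \<odot> power_of x m)) =
            (x \<odot> x) \<odot> (w \<odot> power_of x m) + 2 *\<^sub>R ((x \<odot> w) \<odot> power_of x (Suc m))"
          using jordan_identity_linear[of w x "power_of x m"]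
          by (simp only: n square_jp_power jpower.simps(2)[of _ _ _ m])
        then show ?thesis
          unfolding commute[of w "power_of x n"] commute[of "x \<odot> w"] commute[of w "power_of x m"]
          by (simp only: eq_diff_eq)
      qed
      show ?thesis
        unfolding expand by (simp only: m Sm jordan_identity jp_simps)
    qed
  qed
qed

section \<open>Multiplication by an idempotent and its Peirce components\<close>

lemma idempotent_cubic:
  assumes "c \<odot> c = c"
  shows "2 *\<^sub>R (c \<odot> (c \<odot> (c \<odot> x))) = 3 *\<^sub>R (c \<odot> (c \<odot> x)) - c \<odot> x"
proof -
  have three: "3 *\<^sub>R y = y + y + y" for y :: 'v
    using scaleR_add_left[of 1 2 y] by (simp add: scaleR_2)
  \<comment> \<open>The linearised identity with two arguments equal to \<open>c\<close> says that
    multiplication by \<open>c\<close> is a root of \<open>t (2 t - 1) (t - 1)\<close>.\<close>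
  show ?thesis
    using jordan_identity_linear[of x c c] assms
    by (simp add: commute[of x] commute[of "c \<odot> x"] algebra_simps) (simp add: scaleR_2 three)
qed

text \<open>The cubic equation says that \<open>c \<odot> _\<close> has eigenvalues \<open>0\<close>, \<open>1/2\<close> and \<open>1\<close>; the two
  squares are the components for \<open>1\<close> and \<open>1/2\<close>.\<close>

lemma idempotent_inner_decomp:
  assumes "c \<odot> c = c"
  shows "(c \<odot> x) \<bullet> x = (norm (2 *\<^sub>R (c \<odot> (c \<odot> x)) - c \<odot> x))\<^sup>2
     + 8 * (norm (c \<odot> x - c \<odot> (c \<odot> x)))\<^sup>2"
proof -
  define A where "A = c \<odot> x"
  define B where "B = c \<odot> A"
  define C where "C = c \<odot> B"
  have self: "(c \<odot> u) \<bullet> v = u \<bullet> (c \<odot> v)" for u v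
    by (rule inner_assoc)
  have cubic: "2 *\<^sub>R C = 3 *\<^sub>R B - A" "2 *\<^sub>R (c \<odot> C) = 3 *\<^sub>R C - B"
    using idempotent_cubic[OF assms] by (simp_all add: A_def B_def C_def)
  have Bx: "B \<bullet> x = A \<bullet> A" and Cx: "C \<bullet> x = A \<bullet> B" and Dx: "(c \<odot> C) \<bullet> x = B \<bullet> B"
    by (simp_all add: A_def B_def C_def self inner_commute)
  have "(2 *\<^sub>R C) \<bullet> x = 3 * (B \<bullet> x) - A \<bullet> x" "(2 *\<^sub>R (c \<odot> C)) \<bullet> x = 3 * (C \<bullet> x) - B \<bullet> x"
    unfolding cubic by (simp_all add: inner_diff_left)
  then have "2 * (A \<bullet> B) = 3 * (A \<bullet> A) - A \<bullet> x" "2 * (B \<bullet> B) = 3 * (A \<bullet> B) - A \<bullet> A"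
    using Bx Cx Dx by simp_all
  \<comment> \<open>The component of \<open>x\<close> for 1/2 is four times \<open>A - B\<close>;
    half of its squared norm accounts for the factor 8.\<close>
  then have "A \<bullet> x = (norm (2 *\<^sub>R B - A))\<^sup>2 + 8 * (norm (A - B))\<^sup>2"
    by (simp add: power2_norm_eq_inner inner_diff_left inner_diff_right inner_commute[of B A])
  then show ?thesis by (simp add: A_def B_def)
qed

lemma idempotent_inner_nonneg: "c \<odot> c = c \<Longrightarrow> 0 \<le> (c \<odot> x) \<bullet> x"
  by (simp add: idempotent_inner_decomp)

text \<open>Both squares in the decomposition must vanish, so \<open>c \<odot> (c \<odot> x)\<close>
  equals \<open>c \<odot> x\<close> and also half of it.\<close>

lemma idempotent_inner_zero:
  assumes "c \<odot> c = c" "(c \<odot> x) \<bullet> x = 0"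
  shows "c \<odot> x = 0"
proof -
  have "(norm (2 *\<^sub>R (c \<odot> (c \<odot> x)) - c \<odot> x))\<^sup>2 + 8 * (norm (c \<odot> x - c \<odot> (c \<odot> x)))\<^sup>2 = 0"
    using idempotent_inner_decomp[OF assms(1), of x] assms(2) by simp
  then have "norm (2 *\<^sub>R (c \<odot> (c \<odot> x)) - c \<odot> x) = 0" "norm (c \<odot> x - c \<odot> (c \<odot> x)) = 0"
    by (smt (verit) zero_le_power2 power_eq_0_iff)+
  then have "2 *\<^sub>R (c \<odot> (c \<odot> x)) = c \<odot> x" "c \<odot> (c \<odot> x) = c \<odot> x"
    unfolding norm_eq_zero right_minus_eq by simp_all
  then have "c \<odot> x + c \<odot> x = c \<odot> x" by (metis scaleR_2)
  then show ?thesis by simp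
qed

text \<open>Presents \<open>c \<bullet> d\<close> as the quadratic form of multiplication by
  \<open>c\<close> at \<open>d\<close>, so that its positivity and its zero case carry over to pairs
  of idempotents.\<close>

lemma inner_idempotent: "d \<odot> d = d \<Longrightarrow> c \<bullet> d = (c \<odot> d) \<bullet> d"
  using inner_assoc[of d c d] by (simp add: commute[of c d] inner_commute inner_assoc)

lemma idempotents_inner_nonneg: "c \<odot> c = c \<Longrightarrow> d \<odot> d = d \<Longrightarrow> 0 \<le> c \<bullet> d"
  using idempotent_inner_nonneg[of c d] inner_idempotent[of d c] by simp

lemma idempotents_inner_zero: "c \<odot> c = c \<Longrightarrow> d \<odot> d = d \<Longrightarrow> c \<bullet> d = 0 \<Longrightarrow> c \<odot> d = 0"
  using idempotent_inner_zero[of c d] inner_idempotent[of d c] by simp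

lemma jp_zero_inner: "c \<odot> d = 0 \<Longrightarrow> c \<bullet> d = 0"
  using inner_unit[of c d] by simp

text \<open>Formal reality: pairing \<open>x \<odot> x\<close> with \<open>e\<close> gives
  \<open>x \<bullet> x\<close>.\<close>

lemma jp_self_zero: "x \<odot> x = 0 \<Longrightarrow> x = 0"
  using jp_zero_inner[of x x] by simp

section \<open>Evaluation of real polynomials at an element\<close>

definition jpoly :: "'v \<Rightarrow> real poly \<Rightarrow> 'v" where
  "jpoly x p = (\<Sum>i\<le>degree p. coeff p i *\<^sub>R power_of x i)"

lemma jpoly_eq_sum:
  assumes "degree p \<le> N"
  shows "jpoly x p = (\<Sum>i\<le>N. coeff p i *\<^sub>R power_of x i)"
  unfolding jpoly_def using assms
  by (intro sum.mono_neutral_left) (auto simp: coeff_eq_0)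

lemma jpoly_0 [simp]: "jpoly x 0 = 0"
  by (simp add: jpoly_def)

lemma jpoly_1 [simp]: "jpoly x 1 = e"
  by (simp add: jpoly_def)

lemma jpoly_add: "jpoly x (p + q) = jpoly x p + jpoly x q"
  using degree_add_le_max[of p q]
  by (simp add: jpoly_eq_sum[where N = "max (degree p) (degree q)"] sum.distrib scaleR_add_left)

lemma jpoly_smult: "jpoly x (smult r p) = r *\<^sub>R jpoly x p"
  using degree_smult_le[of r p]
  by (simp add: jpoly_eq_sum[where N = "degree p"] scaleR_sum_right)

lemma jpoly_diff: "jpoly x (p - q) = jpoly x p - jpoly x q"
  using jpoly_add[of x p "smult (-1) q"] jpoly_smult[of x "-1" q] by simp

lemma jpoly_monom: "jpoly x (monom r k) = r *\<^sub>R power_of x k"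
proof -
  have "jpoly x (monom r k) = (\<Sum>i\<le>k. coeff (monom r k) i *\<^sub>R power_of x i)"
    by (rule jpoly_eq_sum) (rule degree_monom_le)
  also have "\<dots> = (\<Sum>i\<le>k. if i = k then r *\<^sub>R power_of x i else 0)"
    by (rule sum.cong) auto
  finally show ?thesis by simp
qed

lemma jpoly_sum: "jpoly x (sum f S) = (\<Sum>i\<in>S. jpoly x (f i))"
  by (induction S rule: infinite_finite_induct) (auto simp: jpoly_add)

lemma jpoly_pCons: "jpoly x (pCons r p) = r *\<^sub>R e + x \<odot> jpoly x p"
proof -
  have "jpoly x (pCons r p) = (\<Sum>i\<le>Suc (degree p). coeff (pCons r p) i *\<^sub>R power_of x i)"
    by (rule jpoly_eq_sum) (simp add: degree_pCons_le)
  also have "\<dots> = r *\<^sub>R e + (\<Sum>i\<le>degree p. coeff p i *\<^sub>R power_of x (Suc i))"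
    by (subst sum.atMost_Suc_shift) simp
  also have "\<dots> = r *\<^sub>R e + x \<odot> jpoly x p"
    by (simp add: jpoly_def jp_sum_right jp_scaleR_right)
  finally show ?thesis .
qed

lemma jpoly_commutes: "jpoly x p \<odot> (x \<odot> z) = x \<odot> (jpoly x p \<odot> z)"
  by (simp add: jpoly_def jp_sum_left jp_sum_right jp_simps power_commutes)

text \<open>Power associativity: since multiplication by a polynomial in \<open>x\<close> commutes
  with multiplication by \<open>x\<close>, one factor \<open>x\<close> at a time can be moved
  outward.\<close>

lemma jpoly_mult: "jpoly x (p * q) = jpoly x p \<odot> jpoly x q"
proof (induction p)
  case 0
  then show ?case by (simp add: jp_simps)
next
  case (pCons r p)
  have "(x \<odot> jpoly x p) \<odot> jpoly x q = x \<odot> (jpoly x p \<odot> jpoly x q)"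
    using jpoly_commutes[of x q "jpoly x p"] by (simp add: commute)
  then show ?case
    by (simp add: jpoly_add jpoly_smult jpoly_pCons pCons.IH jp_simps unit)
qed

lemma jpoly_X: "jpoly x [:0, 1:] = x"
  by (simp add: jpoly_pCons jp_zero_right unit_right)

lemma jpoly_mult_eq_0: "jpoly x p = 0 \<Longrightarrow> jpoly x (p * q) = 0"
  by (simp add: jpoly_mult jp_zero_left)

text \<open>The square of \<open>jpoly x (r * s)\<close> vanishes, and there are no nonzero
  nilpotents. This removes repeated roots from an annihilating polynomial.\<close>

lemma jpoly_square_eq_0:
  assumes "jpoly x (r * r * s) = 0"
  shows "jpoly x (r * s) = 0"
proof -
  have "jpoly x (r * s) \<odot> jpoly x (r * s) = jpoly x ((r * r * s) * s)"
    unfolding jpoly_mult[of x "r * s", symmetric] by (simp only: ac_simps)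
  also have "\<dots> = 0" using assms by (rule jpoly_mult_eq_0)
  finally show ?thesis by (rule jp_self_zero)
qed

text \<open>The quadratic factor is a sum of two squares. After multiplication by a second
  \<open>s\<close>, pairing with \<open>e\<close> yields two squared norms, one with weight
  \<open>b\<^sup>2\<close>, whose sum is 0. This removes irreducible quadratic factors from an
  annihilating polynomial.\<close>

lemma jpoly_quadratic_eq_0:
  assumes "jpoly x (([:-a, 1:] * [:-a, 1:] + [:b\<^sup>2:]) * s) = 0" and "b \<noteq> 0"
  shows "jpoly x s = 0"
proof -
  have expand: "(r * r + t) * u * u = (r * u) * (r * u) + t * u * u" for r t u :: "real poly"
    by (simp add: algebra_simps)
  have "jpoly x (([:-a, 1:] * [:-a, 1:] + [:b\<^sup>2:]) * s * s) = 0"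
    using assms(1) by (rule jpoly_mult_eq_0)
  also have "([:-a, 1:] * [:-a, 1:] + [:b\<^sup>2:]) * s * s =
      ([:-a, 1:] * s) * ([:-a, 1:] * s) + [:b\<^sup>2:] * s * s"
    by (rule expand)
  also have "[:b\<^sup>2:] * s * s = smult (b\<^sup>2) (s * s)"
    by simp
  finally have "e \<bullet> (jpoly x ([:-a, 1:] * s) \<odot> jpoly x ([:-a, 1:] * s)
      + b\<^sup>2 *\<^sub>R (jpoly x s \<odot> jpoly x s)) = 0"
    unfolding jpoly_add jpoly_smult jpoly_mult[of x "[:-a, 1:] * s"] jpoly_mult[of x s] by simp
  then have "(norm (jpoly x ([:-a, 1:] * s)))\<^sup>2 + b\<^sup>2 * (norm (jpoly x s))\<^sup>2 = 0"
    by (simp only: inner_add_right inner_scaleR_right inner_unit power2_norm_eq_inner)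
  then have "b\<^sup>2 * (norm (jpoly x s))\<^sup>2 = 0"
    using add_nonneg_eq_0_iff[of "(norm (jpoly x ([:-a, 1:] * s)))\<^sup>2" "b\<^sup>2 * (norm (jpoly x s))\<^sup>2"]
    by simp
  then show ?thesis using assms(2) by simp
qed

end

section \<open>Factors and interpolation of real polynomials\<close>

lemma map_poly_of_real_add:
  "map_poly of_real (p + q) = map_poly of_real p + (map_poly of_real q :: complex poly)"
  by (rule poly_eqI) (simp add: coeff_map_poly)

lemma map_poly_of_real_smult:
  "map_poly of_real (smult r p) = smult (of_real r) (map_poly of_real p :: complex poly)"
  by (rule poly_eqI) (simp add: coeff_map_poly)

lemma map_poly_of_real_mult:
  "map_poly of_real (p * q) = map_poly of_real p * (map_poly of_real q :: complex poly)"
  by (induction p) (simp_all add: map_poly_of_real_add map_poly_of_real_smult map_poly_pCons)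

lemma real_poly_factor:
  fixes p :: "real poly"
  assumes "degree p > 0"
  obtains (linear) t d where "p = [:-t, 1:] * d"
  | (quadratic) s b d where "b \<noteq> 0" "p = ([:-s, 1:] * [:-s, 1:] + [:b\<^sup>2:]) * d"
proof -
  let ?P = "map_poly of_real p :: complex poly"
  have "degree ?P = degree p" by (rule degree_map_poly) simp
  then have "\<not> constant (poly ?P)" using assms by (simp add: constant_degree)
  then obtain z where z: "poly ?P z = 0" using fundamental_theorem_of_algebra by blast
  show thesis
  proof (cases "Im z = 0")
    case True
    have "poly ?P (of_real t) = of_real (poly p t)" for t
      by (induction p) (simp_all add: map_poly_pCons)
    moreover have "z = of_real (Re z)" using True by (simp add: complex_eq_iff)
    ultimately have "of_real (poly p (Re z)) = (0 :: complex)" using z by metis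
    then have "poly p (Re z) = 0" by simp
    then show thesis using linear by (auto simp: poly_eq_0_iff_dvd dvd_def)
  next
    case False
    \<comment> \<open>The real quadratic with roots \<open>z\<close> and its conjugate. The
      remainder modulo \<open>m\<close> is real, of degree at most 1 and zero at the nonreal
      \<open>z\<close>, hence it is 0.\<close>
    define m where "m = [:- Re z, 1:] * [:- Re z, 1:] + [:(Im z)\<^sup>2:]"
    have m0: "poly (map_poly of_real m) z = 0"
      by (simp add: m_def map_poly_of_real_add map_poly_of_real_mult map_poly_pCons complex_eq_iff
          power2_eq_square algebra_simps)
    have "degree m = 2" by (simp add: m_def)
    then have "m \<noteq> 0" by (metis degree_0 zero_neq_numeral)
    let ?r = "p mod m"
    have deg: "degree ?r < 2"
      using degree_mod_less'[of m p] \<open>degree m = 2\<close> \<open>m \<noteq> 0\<close> by (cases "?r = 0") auto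
    have p: "p = m * (p div m) + ?r" by simp
    have "poly (map_poly of_real (m * (p div m) + ?r)) z = 0" using z p by simp
    then have r0: "poly (map_poly of_real ?r) z = 0"
      unfolding map_poly_of_real_add map_poly_of_real_mult[of m] poly_add poly_mult m0 by simp
    obtain r0 r1 where r: "?r = [:r0, r1:]"
    proof (cases ?r)
      case (pCons u v)
      then have "degree v = 0" using deg by (auto split: if_splits)
      then show ?thesis using that pCons degree_eq_zeroE by metis
    qed
    have "of_real r0 + z * of_real r1 = 0"
      using r0 unfolding r by (simp add: map_poly_pCons)
    then have "r1 = 0" "r0 = 0" using False by (auto simp: complex_eq_iff)
    then have "p = m * (p div m)" using p r by simp
    then show thesis using quadratic[OF False] unfolding m_def by blast
  qed
qed

lemma prod_linear_dvd:
  fixes p :: "real poly"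
  assumes "finite T" "\<And>t. t \<in> T \<Longrightarrow> poly p t = 0"
  shows "(\<Prod>t\<in>T. [:-t, 1:]) dvd p"
  using assms
proof (induction T arbitrary: p rule: finite_induct)
  case empty
  then show ?case by simp
next
  case (insert s T)
  then obtain d where p: "p = [:-s, 1:] * d" by (auto simp: poly_eq_0_iff_dvd dvd_def)
  have "poly d t = 0" if "t \<in> T" for t
    using insert.prems[of t] insert.hyps(2) that by (auto simp: p)
  then have "(\<Prod>t\<in>T. [:-t, 1:]) dvd d" by (rule insert.IH)
  then show ?case using insert.hyps p by (simp add: mult_dvd_mono del: mult_pCons_left)
qed

text \<open>Lagrange interpolation; \<open>?l t\<close> is the basis polynomial of the node
  \<open>t\<close> before normalisation.\<close>

lemma interpolation_poly:
  assumes "finite (T :: real set)"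
  shows "\<exists>p. \<forall>t\<in>T. poly p t = g t"
proof -
  let ?l = "\<lambda>t. \<Prod>s\<in>T - {t}. [:-s, 1:]"
  have l: "poly (?l t) u = 0 \<longleftrightarrow> u \<noteq> t" if "u \<in> T" for t u
    using that assms by (auto simp: poly_prod)
  have "poly (\<Sum>s\<in>T. smult (g s / poly (?l s) s) (?l s)) t = g t" if t: "t \<in> T" for t
  proof -
    have "poly (\<Sum>s\<in>T. smult (g s / poly (?l s) s) (?l s)) t =
        (\<Sum>s\<in>T. if s = t then g t else 0)"
      unfolding poly_sum poly_smult using l t by (intro sum.cong) auto
    then show ?thesis using assms t by simp
  qed
  then show ?thesis by blast
qed


section \<open>The spectral theorem\<close>

context euclidean_jordan_algebra
begin

text \<open>A linear factor of \<open>p\<close> is moved over to \<open>q\<close> and a quadratic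
  one is dropped. The parameter \<open>q\<close> holds the linear factors set aside, so that the
  induction hypothesis applies to the cofactor \<open>d\<close>.\<close>

lemma annihilator_split:
  assumes "p \<noteq> 0" "jpoly x (p * q) = 0"
  shows "\<exists>T. finite T \<and> jpoly x ((\<Prod>t\<in>T. [:-t, 1:]) * q) = 0"
  using assms
proof (induction "degree p" arbitrary: p q rule: less_induct)
  case less
  show ?case
  proof (cases "degree p = 0")
    case True
    then obtain r where "p = [:r:]" "r \<noteq> 0" using less.prems(1) by (metis degree_eq_zeroE pCons_0_0)
    then have "jpoly x q = 0" using less.prems(2) by (simp add: jpoly_smult)
    then show ?thesis by (intro exI[of _ "{}"]) simp
  next
    case False
    then have "degree p > 0" by simp
    then show ?thesis
    proof (cases rule: real_poly_factor)
      case (linear t d)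
      have "d \<noteq> 0" using linear less.prems(1) by auto
      then have "degree d < degree p" unfolding linear by (subst degree_mult_eq) auto
      moreover have "jpoly x (d * ([:-t, 1:] * q)) = 0"
        using less.prems(2) unfolding linear by (simp only: ac_simps)
      ultimately obtain T where T: "finite T"
        "jpoly x ((\<Prod>t\<in>T. [:-t, 1:]) * ([:-t, 1:] * q)) = 0"
        using less.hyps \<open>d \<noteq> 0\<close> by blast
      \<comment> \<open>If \<open>t\<close> is already in \<open>T\<close>, the factor occurs twice
        and one copy is cancelled; otherwise \<open>T\<close> grows by \<open>t\<close>.\<close>
      show ?thesis
      proof (cases "t \<in> T")
        case True
        then have fac: "(\<Prod>t\<in>T. [:-t, 1:]) = [:-t, 1:] * (\<Prod>t\<in>T - {t}. [:-t, 1:])"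
          using T(1) by (simp add: prod.remove del: mult_pCons_left)
        have "jpoly x ([:-t, 1:] * [:-t, 1:] * ((\<Prod>t\<in>T - {t}. [:-t, 1:]) * q)) = 0"
          using T(2) unfolding fac by (simp only: ac_simps)
        then have "jpoly x ([:-t, 1:] * ((\<Prod>t\<in>T - {t}. [:-t, 1:]) * q)) = 0"
          by (rule jpoly_square_eq_0)
        then have "jpoly x ((\<Prod>t\<in>T. [:-t, 1:]) * q) = 0"
          unfolding fac by (simp only: ac_simps)
        then show ?thesis using T(1) by blast
      next
        case False
        then have "(\<Prod>t\<in>insert t T. [:-t, 1:]) * q = (\<Prod>t\<in>T. [:-t, 1:]) * ([:-t, 1:] * q)"
          unfolding prod.insert[OF T(1) False] by (simp only: ac_simps)
        then show ?thesis using T by (intro exI[of _ "insert t T"]) simp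
      qed
    next
      case (quadratic s b d)
      have "d \<noteq> 0" using quadratic less.prems(1) by auto
      moreover have "[:-s, 1:] * [:-s, 1:] + [:b\<^sup>2:] \<noteq> 0" by simp
      ultimately have "degree d < degree p"
        unfolding quadratic(2) by (subst degree_mult_eq) auto
      moreover have "jpoly x (([:-s, 1:] * [:-s, 1:] + [:b\<^sup>2:]) * (d * q)) = 0"
        using less.prems(2) unfolding quadratic(2) by (simp only: mult.assoc)
      then have "jpoly x (d * q) = 0" using quadratic(1) by (rule jpoly_quadratic_eq_0)
      ultimately show ?thesis using less.hyps \<open>d \<noteq> 0\<close> by blast
    qed
  qed
qed

lemma power_span:
  assumes "v \<in> span (power_of x ` {..<m})"
  shows "\<exists>q. v = jpoly x q \<and> (\<forall>i\<ge>m. coeff q i = 0)"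
proof -
  let ?S = "{jpoly x q | q. \<forall>i\<ge>m. coeff q i = 0}"
  have "subspace ?S"
    unfolding subspace_def
  proof (intro conjI ballI allI)
    show "0 \<in> ?S" by (auto intro: exI[of _ 0])
    show "u + w \<in> ?S" if "u \<in> ?S" "w \<in> ?S" for u w
    proof -
      obtain p q where "u = jpoly x p" "\<forall>i\<ge>m. coeff p i = 0" "w = jpoly x q" "\<forall>i\<ge>m. coeff q i = 0"
        using \<open>u \<in> ?S\<close> \<open>w \<in> ?S\<close> by blast
      then show ?thesis by (auto intro!: exI[of _ "p + q"] simp: jpoly_add)
    qed
    show "r *\<^sub>R u \<in> ?S" if "u \<in> ?S" for r u
    proof -
      obtain p where "u = jpoly x p" "\<forall>i\<ge>m. coeff p i = 0" using \<open>u \<in> ?S\<close> by blast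
      then show ?thesis by (auto intro!: exI[of _ "smult r p"] simp: jpoly_smult)
    qed
  qed
  moreover have "power_of x ` {..<m} \<subseteq> ?S"
  proof
    fix u assume "u \<in> power_of x ` {..<m}"
    then obtain i where "i < m" "u = power_of x i" by auto
    then show "u \<in> ?S" by (auto intro!: exI[of _ "monom 1 i"] simp: jpoly_monom)
  qed
  ultimately have "span (power_of x ` {..<m}) \<subseteq> ?S" by (rule span_minimal[rotated])
  then show ?thesis using assms by blast
qed

lemma power_span_annihilator:
  assumes "power_of x m \<in> span (power_of x ` {..<m})"
  obtains p where "p \<noteq> 0" "degree p \<le> m" "jpoly x p = 0"
proof -
  obtain q where q: "power_of x m = jpoly x q" "\<forall>i\<ge>m. coeff q i = 0"
    using power_span[OF assms] by blast
  let ?p = "monom 1 m - q"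
  have "coeff ?p m = 1" using q(2) by simp
  then have "?p \<noteq> 0" by (metis coeff_0 zero_neq_one)
  moreover have "degree ?p \<le> m"
    using q(2) by (intro degree_le) simp
  moreover have "jpoly x ?p = 0" by (simp add: jpoly_diff jpoly_monom q(1))
  ultimately show thesis by (rule that)
qed

text \<open>Otherwise the first \<open>k\<close> powers would span a space of dimension
  \<open>k\<close> for every \<open>k\<close>. It makes the \<open>LEAST\<close> in
  \<open>jdegree\<close> meaningful.\<close>

lemma power_dependent: "\<exists>k. power_of x k \<in> span (power_of x ` {..<k})"
proof (rule ccontr)
  assume "\<not> ?thesis"
  then have "dim (power_of x ` {..<k}) = k" for k
    by (induction k) (simp_all add: dim_insert lessThan_Suc)
  then have "Suc DIM('v) \<le> DIM('v)"
    using dim_subset_UNIV[of "power_of x ` {..<Suc DIM('v)}"] by metis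
  then show False by simp
qed

lemma jpoly_split_annihilator: "\<exists>T. finite T \<and> jpoly x (\<Prod>t\<in>T. [:-t, 1:]) = 0"
proof -
  obtain k where "power_of x k \<in> span (power_of x ` {..<k})" using power_dependent by blast
  then obtain p where "p \<noteq> 0" "jpoly x p = 0" by (rule power_span_annihilator)
  then show ?thesis using annihilator_split[of p x 1] by simp
qed

section \<open>Complete systems of orthogonal idempotents\<close>

definition idempotent_system :: "'v set \<Rightarrow> bool" where
  "idempotent_system F \<longleftrightarrow> finite F \<and> (\<forall>c\<in>F. c \<odot> c = c \<and> c \<noteq> 0) \<and>
     (\<forall>c\<in>F. \<forall>d\<in>F. c \<noteq> d \<longrightarrow> c \<odot> d = 0) \<and> \<Sum>F = e"

text \<open>A polynomial that vanishes on the finite set \<open>T\<close> of simple roots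
  annihilates \<open>x\<close>, so only values on \<open>T\<close> matter. The Lagrange polynomials
  act there as indicators of points, and their values at \<open>x\<close> are therefore orthogonal
  idempotents with sum \<open>e\<close> and eigenvectors of multiplication by
  \<open>x\<close>.\<close>

lemma spectral_decomposition:
  "\<exists>F. idempotent_system F \<and> (\<forall>c\<in>F. \<exists>r. x \<odot> c = r *\<^sub>R c)"
proof -
  obtain T where T: "finite T" "jpoly x (\<Prod>t\<in>T. [:-t, 1:]) = 0"
    using jpoly_split_annihilator by blast
  have vanish: "jpoly x p = 0" if "\<And>t. t \<in> T \<Longrightarrow> poly p t = 0" for p
    using prod_linear_dvd[OF T(1) that] jpoly_mult_eq_0[OF T(2)] by (auto simp: dvd_def)
  have "\<exists>p. \<forall>s\<in>T. poly p s = (if s = t then 1 else 0)" for t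
    by (rule interpolation_poly) (rule T(1))
  then obtain l where l: "\<And>t s. s \<in> T \<Longrightarrow> poly (l t) s = (if s = t then 1 else 0)"
    by metis
  define f where "f t = jpoly x (l t)" for t
  have orth: "f s \<odot> f t = 0" if "s \<noteq> t" for s t
    unfolding f_def jpoly_mult[symmetric] using l that by (intro vanish) simp
  then have orth': "f s \<odot> f t = 0" if "f s \<noteq> f t" for s t
    using that by metis
  have idem: "f t \<odot> f t = f t" for t
  proof -
    have "jpoly x (l t * l t - l t) = 0" using l by (intro vanish) simp
    then show ?thesis by (simp add: f_def jpoly_diff jpoly_mult)
  qed
  have eigen: "x \<odot> f t = t *\<^sub>R f t" for t
  proof -
    have "jpoly x ([:0, 1:] * l t - smult t (l t)) = 0" using l by (intro vanish) simp
    then show ?thesis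
      unfolding jpoly_diff jpoly_mult jpoly_X jpoly_smult by (simp add: f_def)
  qed
  have unity: "(\<Sum>t\<in>T. f t) = e"
  proof -
    have "jpoly x ((\<Sum>t\<in>T. l t) - 1) = 0"
      using l T(1) by (intro vanish) (simp add: poly_sum)
    then show ?thesis by (simp add: f_def jpoly_diff jpoly_sum)
  qed
  \<comment> \<open>If \<open>f s = f t\<close> for distinct \<open>s\<close> and \<open>t\<close>,
    then \<open>f s = f s \<odot> f t = 0\<close>, so passing to the image loses nothing. The set
    \<open>T\<close> need not be minimal; some \<open>f t\<close> may be 0 and are
    discarded.\<close>
  have "\<Sum>(f ` T) = (\<Sum>t\<in>T. f t)"
    using T(1) orth idem
    by (subst sum.reindex_nontrivial) (auto, metis)
  moreover have "\<Sum>(f ` T - {0}) = \<Sum>(f ` T)"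
    using T(1) by (intro sum.mono_neutral_left) auto
  ultimately have "idempotent_system (f ` T - {0})"
    unfolding idempotent_system_def using T(1) orth' idem unity by auto
  moreover have "\<forall>c\<in>f ` T - {0}. \<exists>r. x \<odot> c = r *\<^sub>R c" using eigen by auto
  ultimately show ?thesis by blast
qed

text \<open>A zero Jordan product entails a zero inner product, so the system is linearly
  independent. The bound provides systems of maximal cardinality.\<close>

lemma idempotent_system_card:
  assumes "idempotent_system F"
  shows "card F \<le> DIM('v)"
proof -
  have "pairwise orthogonal F"
    using assms jp_zero_inner
    by (auto simp: pairwise_def orthogonal_def idempotent_system_def)
  then have "independent F"
    using assms by (intro pairwise_orthogonal_independent) (auto simp: idempotent_system_def)
  then show ?thesis using independent_bound by blast
qed

lemma idempotent_system_expand: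
  assumes "idempotent_system F" "\<And>c. c \<in> F \<Longrightarrow> x \<odot> c = h c *\<^sub>R c"
  shows "x = (\<Sum>c\<in>F. h c *\<^sub>R c)"
proof -
  have "x = x \<odot> \<Sum>F" using assms(1) by (simp add: idempotent_system_def unit_right)
  also have "\<dots> = (\<Sum>c\<in>F. h c *\<^sub>R c)" using assms(2) by (simp add: jp_sum_right)
  finally show ?thesis .
qed

lemma idempotent_system_jp:
  assumes "idempotent_system F" "c \<in> F"
  shows "(\<Sum>d\<in>F. h d *\<^sub>R d) \<odot> c = h c *\<^sub>R c"
proof -
  have "(\<Sum>d\<in>F. h d *\<^sub>R d) \<odot> c = (\<Sum>d\<in>F. if d = c then h c *\<^sub>R c else 0)"
    unfolding jp_sum_left jp_scaleR_left using assms
    by (intro sum.cong) (auto simp: idempotent_system_def)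
  also have "\<dots> = h c *\<^sub>R c" using assms by (simp add: idempotent_system_def)
  finally show ?thesis .
qed

lemma idempotent_split:
  assumes "c1 \<odot> c1 = c1" "c2 \<odot> c2 = c2" "(c1 + c2) \<odot> (c1 + c2) = c1 + c2"
  shows "c1 \<odot> c2 = 0"
proof -
  have "c1 \<odot> c2 + c1 \<odot> c2 = 0"
    using assms by (simp add: jp_simps commute[of c2 c1] algebra_simps)
  then show ?thesis by (simp flip: scaleR_2)
qed

text \<open>A Jordan frame as a set, so that cardinalities of frames can be compared before an index
  type of the right size is at hand.\<close>

definition frame :: "'v set \<Rightarrow> bool" where
  "frame F \<longleftrightarrow> idempotent_system F \<and> (\<forall>c\<in>F. primitive_idempotent (\<odot>) c)"

text \<open>An eigen-system of idempotents of maximal cardinality consists of primitive ones, since a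
  splitting \<open>c = c1 + c2\<close> of a member would give a larger system.\<close>

lemma frame_exists:
  "\<exists>F. frame F \<and> (\<forall>c\<in>F. \<exists>r. x \<odot> c = r *\<^sub>R c)"
proof -
  let ?P = "\<lambda>F. idempotent_system F \<and> (\<forall>c\<in>F. \<exists>r. x \<odot> c = r *\<^sub>R c)"
  obtain F0 where "?P F0" using spectral_decomposition by blast
  then have "\<exists>F. ?P F \<and> (\<forall>G. ?P G \<longrightarrow> card G \<le> card F)"
    using idempotent_system_card by (intro ex_has_greatest_nat[of ?P F0 card "Suc DIM('v)"]) (auto simp: less_Suc_eq_le)
  then obtain F where F: "?P F" and greatest: "\<And>G. ?P G \<Longrightarrow> card G \<le> card F"
    by blast
  from F have sys: "finite F" "\<And>c. c \<in> F \<Longrightarrow> c \<odot> c = c" "\<And>c. c \<in> F \<Longrightarrow> c \<noteq> 0"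
    "\<And>c d. c \<in> F \<Longrightarrow> d \<in> F \<Longrightarrow> c \<noteq> d \<Longrightarrow> c \<odot> d = 0" "\<Sum>F = e"
    by (auto simp: idempotent_system_def)
  obtain h where h: "\<And>c. c \<in> F \<Longrightarrow> x \<odot> c = h c *\<^sub>R c" using F by metis
  have x: "x = (\<Sum>c\<in>F. h c *\<^sub>R c)" using F h by (intro idempotent_system_expand) auto
  have "primitive_idempotent (\<odot>) c" if c: "c \<in> F" for c
  proof (rule ccontr)
    assume "\<not> primitive_idempotent (\<odot>) c"
    then obtain c1 c2 where split: "c1 \<odot> c1 = c1" "c2 \<odot> c2 = c2" "c1 \<noteq> 0" "c2 \<noteq> 0" "c = c1 + c2"
      using sys c by (auto simp: primitive_idempotent_def idempotent_def)
    have c12: "c1 \<odot> c2 = 0" using idempotent_split split sys(2)[OF c] by simp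
    \<comment> \<open>Both inner products are nonnegative and they add up to
      \<open>d \<bullet> c = 0\<close>; for idempotents a zero inner product forces a zero Jordan
      product.\<close>
    have others: "d \<odot> c1 = 0 \<and> d \<odot> c2 = 0" if d: "d \<in> F - {c}" for d
    proof -
      have "d \<bullet> c1 + d \<bullet> c2 = 0"
        using jp_zero_inner[of d c] sys(4)[of d c] c d split(5) by (simp add: inner_add_right)
      moreover have "d \<bullet> c1 \<ge> 0" "d \<bullet> c2 \<ge> 0"
        using idempotents_inner_nonneg split sys d by auto
      ultimately have "d \<bullet> c1 = 0" "d \<bullet> c2 = 0" by auto
      moreover have "d \<odot> d = d" using sys(2) d by simp
      ultimately show ?thesis using idempotents_inner_zero split(1,2) by blast
    qed
    have eigen: "x \<odot> ci = h c *\<^sub>R ci" if "c \<odot> ci = ci" "\<And>d. d \<in> F - {c} \<Longrightarrow> d \<odot> ci = 0" for ci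
    proof -
      have "x \<odot> ci = (\<Sum>d\<in>F. h d *\<^sub>R (d \<odot> ci))"
        by (subst x) (simp add: jp_sum_left jp_scaleR_left)
      also have "\<dots> = (\<Sum>d\<in>F. if d = c then h c *\<^sub>R ci else 0)"
        using that by (intro sum.cong) auto
      finally show ?thesis using c sys(1) by simp
    qed
    have cc: "c \<odot> c1 = c1" "c \<odot> c2 = c2"
      using split c12 by (simp_all add: jp_simps commute[of c2 c1])
    have notin: "c1 \<notin> F - {c}" "c2 \<notin> F - {c}" "c1 \<noteq> c2"
      using others split c12 by auto
    let ?G = "insert c1 (insert c2 (F - {c}))"
    have "\<Sum>?G = c1 + (c2 + \<Sum>(F - {c}))" using notin sys(1) by simp
    also have "\<dots> = e" using sum.remove[OF sys(1) c, of "\<lambda>x. x"] sys(5) split(5) by simp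
    finally have total: "\<Sum>?G = e" .
    have "c2 \<odot> c1 = 0" using c12 commute by metis
    moreover have "c1 \<odot> d = 0 \<and> c2 \<odot> d = 0" if "d \<in> F - {c}" for d
      using others[OF that] commute by metis
    ultimately have "\<forall>u\<in>?G. \<forall>v\<in>?G. u \<noteq> v \<longrightarrow> u \<odot> v = 0"
      using others c12 sys(4) by blast
    moreover have "\<forall>u\<in>?G. u \<odot> u = u \<and> u \<noteq> 0"
      using sys(2,3) split(1-4) by blast
    ultimately have "idempotent_system ?G"
      unfolding idempotent_system_def using total sys(1) by blast
    moreover have "\<forall>d\<in>?G. \<exists>r. x \<odot> d = r *\<^sub>R d"
      using eigen cc others h by blast
    ultimately have "card ?G \<le> card F" using greatest by blast
    moreover have "card ?G = Suc (card F)"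
      using notin sys(1) c card.remove[OF sys(1) c] by simp
    ultimately show False by simp
  qed
  then show ?thesis using F by (auto simp: frame_def)
qed

section \<open>Primitive idempotents, trace and rank\<close>

lemma primitive_idempotent_nonzero: "primitive_idempotent (\<odot>) c \<Longrightarrow> c \<noteq> 0"
  and primitive_idempotent_jp: "primitive_idempotent (\<odot>) c \<Longrightarrow> c \<odot> c = c"
  by (simp_all add: primitive_idempotent_def idempotent_def)

lemma frame_finite: "frame F \<Longrightarrow> finite F"
  and frame_system: "frame F \<Longrightarrow> idempotent_system F"
  and frame_sum: "frame F \<Longrightarrow> \<Sum>F = e"
  and frame_primitive: "frame F \<Longrightarrow> c \<in> F \<Longrightarrow> primitive_idempotent (\<odot>) c"
  by (simp_all add: frame_def idempotent_system_def)

lemma complement_idempotent: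
  assumes "c \<odot> c = c"
  shows "(e - c) \<odot> (e - c) = e - c"
  using assms by (simp add: jp_simps unit unit_right)

text \<open>Diagonalise \<open>y\<close>. From \<open>c \<odot> y = y\<close> it follows that
  \<open>y \<odot> y\<close> is orthogonal to \<open>e - c\<close>, hence so is every
  \<open>d\<close> with nonzero coefficient, by nonnegativity. Then \<open>c \<odot> d = d\<close>,
  so \<open>c - d\<close> is idempotent, and primitivity gives \<open>d = c\<close>.\<close>

lemma primitive_peirce_one:
  assumes c: "primitive_idempotent (\<odot>) c" and y: "c \<odot> y = y"
  shows "\<exists>r. y = r *\<^sub>R c"
proof -
  have cc: "c \<odot> c = c" using c by (rule primitive_idempotent_jp)
  obtain F where F: "idempotent_system F" "\<forall>d\<in>F. \<exists>r. y \<odot> d = r *\<^sub>R d"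
    using spectral_decomposition by blast
  then obtain h where h: "\<And>d. d \<in> F \<Longrightarrow> y \<odot> d = h d *\<^sub>R d" by metis
  have sys: "finite F" "\<And>d. d \<in> F \<Longrightarrow> d \<odot> d = d" "\<And>d. d \<in> F \<Longrightarrow> d \<noteq> 0"
    using F(1) by (auto simp: idempotent_system_def)
  have expand: "y = (\<Sum>d\<in>F. h d *\<^sub>R d)" using F(1) h by (rule idempotent_system_expand)
  have square: "y \<odot> y = (\<Sum>d\<in>F. (h d)\<^sup>2 *\<^sub>R d)"
    by (subst (2) expand) (simp add: jp_sum_right jp_scaleR_right h power2_eq_square)
  have "(y \<odot> y) \<bullet> c = y \<bullet> y" using inner_assoc[of y y c] y by (simp add: commute[of y c])
  then have "(e - c) \<bullet> (y \<odot> y) = 0"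
    using inner_unit[of y y] by (simp add: inner_diff_left inner_commute)
  then have "(\<Sum>d\<in>F. (h d)\<^sup>2 * ((e - c) \<bullet> d)) = 0"
    unfolding square by (simp add: inner_sum_right)
  moreover have nonneg: "(e - c) \<bullet> d \<ge> 0" if "d \<in> F" for d
    using complement_idempotent[OF cc] sys(2)[OF that] by (rule idempotents_inner_nonneg)
  ultimately have zero: "(h d)\<^sup>2 * ((e - c) \<bullet> d) = 0" if "d \<in> F" for d
    using that sys(1) by (subst (asm) sum_nonneg_eq_0_iff) auto
  have "d = c" if d: "d \<in> F" "h d \<noteq> 0" for d
  proof -
    have "(e - c) \<bullet> d = 0" using zero[OF d(1)] d(2) by simp
    then have "(e - c) \<odot> d = 0"
      using complement_idempotent[OF cc] sys(2)[OF d(1)] by (intro idempotents_inner_zero)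
    then have cd: "c \<odot> d = d" by (simp add: jp_simps unit)
    have "(c - d) \<odot> (c - d) = c - d"
      using cd cc sys(2)[OF d(1)] by (simp add: jp_simps commute[of d c])
    moreover have "c = d + (c - d)" by simp
    ultimately have "c - d = 0"
      using c sys(2,3)[OF d(1)] unfolding primitive_idempotent_def idempotent_def by blast
    then show ?thesis by simp
  qed
  then have "y = (\<Sum>d\<in>F. if d = c then h c *\<^sub>R c else 0)"
    by (subst expand) (rule sum.cong, auto)
  then have "y = (if c \<in> F then h c else 0) *\<^sub>R c" using sys(1) by simp
  then show ?thesis by blast
qed

text \<open>The polynomial \<open>2 t^2 - t\<close> is 1 at 1 and 0 at 0 and 1/2, so the left side
  is the Peirce component of \<open>x\<close> for the eigenvalue 1. It lies on the line through
  \<open>c\<close>; pairing with \<open>c\<close> gives the coefficient.\<close>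

lemma primitive_quadratic:
  assumes "primitive_idempotent (\<odot>) c"
  shows "2 *\<^sub>R (c \<odot> (c \<odot> x)) - c \<odot> x = ((c \<bullet> x) / (c \<bullet> c)) *\<^sub>R c"
proof -
  let ?y = "2 *\<^sub>R (c \<odot> (c \<odot> x)) - c \<odot> x"
  have cc: "c \<odot> c = c" using assms by (rule primitive_idempotent_jp)
  have three: "3 *\<^sub>R v = 2 *\<^sub>R v + v" for v :: 'v
    using scaleR_add_left[of 2 1 v] by simp
  have "c \<odot> ?y = ?y"
    using idempotent_cubic[OF cc, of x] by (simp add: jp_simps three)
  then obtain r where r: "?y = r *\<^sub>R c" using primitive_peirce_one assms by blast
  have "(c \<odot> u) \<bullet> c = u \<bullet> c" for u using inner_assoc[of c u c] cc by simp
  then have "?y \<bullet> c = c \<bullet> x" by (simp add: inner_diff_left inner_commute[of c x])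
  then have "r = (c \<bullet> x) / (c \<bullet> c)"
    using r primitive_idempotent_nonzero[OF assms] by (simp add: eq_divide_eq)
  then show ?thesis using r by simp
qed

text \<open>\<open>primitive_quadratic\<close> at \<open>d\<close>, paired with \<open>d\<close>.
  The point of this form is that the left side is symmetric in \<open>c\<close> and
  \<open>d\<close>.\<close>

lemma primitive_inner_quadratic:
  assumes "primitive_idempotent (\<odot>) c" "d \<odot> d = d"
  shows "2 * ((c \<odot> d) \<bullet> (c \<odot> d)) - c \<bullet> d = (c \<bullet> d)\<^sup>2 / (c \<bullet> c)"
proof -
  have "(2 *\<^sub>R (c \<odot> (c \<odot> d)) - c \<odot> d) \<bullet> d = (c \<bullet> d)\<^sup>2 / (c \<bullet> c)"
    unfolding primitive_quadratic[OF assms(1)] by (simp add: power2_eq_square)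
  moreover have "(c \<odot> (c \<odot> d)) \<bullet> d = (c \<odot> d) \<bullet> (c \<odot> d)" by (rule inner_assoc)
  moreover have "(c \<odot> d) \<bullet> d = c \<bullet> d" using inner_idempotent[OF assms(2), of c] by simp
  ultimately show ?thesis by (simp add: inner_diff_left)
qed

text \<open>With the quadratic representation \<open>P(c)x = 2 c (c x) - c x\<close> one has
  \<open>\<langle>P(c)d, d\<rangle> = \<langle>P(d)c, c\<rangle>\<close>, and for primitive idempotents both sides are multiples of
  \<open>\<langle>c, d\<rangle>\<^sup>2\<close>, with factors \<open>1 / \<langle>c, c\<rangle>\<close> and \<open>1 / \<langle>d, d\<rangle>\<close>.\<close>

lemma primitive_transition_symmetric:
  assumes c: "primitive_idempotent (\<odot>) c" and d: "primitive_idempotent (\<odot>) d"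
  shows "(d \<bullet> c) / (c \<bullet> c) = (d \<bullet> c) / (d \<bullet> d)"
proof -
  have "(c \<bullet> d)\<^sup>2 / (c \<bullet> c) = (d \<bullet> c)\<^sup>2 / (d \<bullet> d)"
    using primitive_inner_quadratic[OF c primitive_idempotent_jp[OF d]]
      primitive_inner_quadratic[OF d primitive_idempotent_jp[OF c]]
    by (simp add: commute[of d c] inner_commute[of d c])
  then have "(d \<bullet> c) * ((d \<bullet> c) / (c \<bullet> c)) = (d \<bullet> c) * ((d \<bullet> c) / (d \<bullet> d))"
    by (simp add: power2_eq_square inner_commute[of c d])
  then show ?thesis by auto
qed

section \<open>The trace functional of a frame\<close>

definition frame_trace :: "'v set \<Rightarrow> 'v \<Rightarrow> real" where
  "frame_trace F x = (\<Sum>c\<in>F. (x \<bullet> c) / (c \<bullet> c))"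

lemma linear_frame_trace: "linear (frame_trace F)"
  by (rule linearI)
    (simp_all add: frame_trace_def inner_add_left add_divide_distrib sum.distrib sum_distrib_left)

text \<open>By symmetry each denominator \<open>c \<bullet> c\<close> may be replaced by
  \<open>d \<bullet> d\<close>; the numerators then add up to
  \<open>d \<bullet> e = d \<bullet> d\<close>.\<close>

lemma frame_trace_primitive:
  assumes F: "frame F" and d: "primitive_idempotent (\<odot>) d"
  shows "frame_trace F d = 1"
proof -
  have "frame_trace F d = (\<Sum>c\<in>F. (d \<bullet> c) / (d \<bullet> d))"
    unfolding frame_trace_def
    by (intro sum.cong refl primitive_transition_symmetric frame_primitive[OF F] d)
  also have "\<dots> = (d \<bullet> \<Sum>F) / (d \<bullet> d)" by (simp add: inner_sum_right sum_divide_distrib)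
  also have "d \<bullet> \<Sum>F = d \<bullet> d"
    using inner_unit[of d d] primitive_idempotent_jp[OF d] frame_sum[OF F]
    by (simp add: inner_commute)
  finally show ?thesis using primitive_idempotent_nonzero[OF d] by simp
qed

lemma frame_trace_expansion:
  assumes "frame F" "frame G"
  shows "frame_trace F (\<Sum>d\<in>G. h d *\<^sub>R d) = (\<Sum>d\<in>G. h d)"
  using frame_trace_primitive[OF assms(1) frame_primitive[OF assms(2)]]
  by (simp add: linear_sum[OF linear_frame_trace] linear_cmul[OF linear_frame_trace])

text \<open>Every frame sums to \<open>e\<close>, so its cardinality is the value at
  \<open>e\<close> of the one functional \<open>frame_trace F\<close>.\<close>

lemma frame_card_eq:
  assumes "frame F" "frame G"
  shows "card F = card G"
proof -
  have "real (card G) = frame_trace F e" if "frame G" for G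
    using frame_trace_expansion[OF assms(1) that, of "\<lambda>_. 1"] frame_sum[OF that] by simp
  then show ?thesis using assms by (metis of_nat_eq_iff)
qed

lemma jpoly_expansion:
  assumes F: "idempotent_system F"
  shows "jpoly (\<Sum>c\<in>F. h c *\<^sub>R c) p = (\<Sum>c\<in>F. poly p (h c) *\<^sub>R c)"
proof (induction p)
  case 0
  then show ?case by simp
next
  case (pCons r p)
  have "(\<Sum>c\<in>F. h c *\<^sub>R c) \<odot> (\<Sum>c\<in>F. poly p (h c) *\<^sub>R c) =
      (\<Sum>c\<in>F. (h c * poly p (h c)) *\<^sub>R c)"
    by (simp add: jp_sum_right jp_scaleR_right idempotent_system_jp[OF F] mult.commute)
  moreover have "r *\<^sub>R e = (\<Sum>c\<in>F. r *\<^sub>R c)"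
    using F by (simp add: idempotent_system_def flip: scaleR_sum_right)
  ultimately show ?case
    by (simp add: jpoly_pCons pCons.IH scaleR_add_left sum.distrib)
qed

section \<open>Degree of an element and rank of the algebra\<close>

lemma jdegree_le: "power_of x k \<in> span (power_of x ` {..<k}) \<Longrightarrow> jdegree (\<odot>) e x \<le> k"
  unfolding jdegree_def by (rule Least_le)

lemma jdegree_span:
  "power_of x (jdegree (\<odot>) e x) \<in> span (power_of x ` {..<jdegree (\<odot>) e x})"
  unfolding jdegree_def using power_dependent by (rule LeastI_ex)

lemma jdegree_le_annihilator:
  assumes "p \<noteq> 0" "jpoly x p = 0"
  shows "jdegree (\<odot>) e x \<le> degree p"
proof (rule jdegree_le)
  have "(\<Sum>i<degree p. coeff p i *\<^sub>R power_of x i) + lead_coeff p *\<^sub>R power_of x (degree p) = 0"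
    using assms(2) by (simp add: jpoly_def flip: lessThan_Suc_atMost)
  then have "lead_coeff p *\<^sub>R power_of x (degree p) =
      - (\<Sum>i<degree p. coeff p i *\<^sub>R power_of x i)"
    by (simp add: eq_neg_iff_add_eq_0 add.commute)
  also have "\<dots> \<in> span (power_of x ` {..<degree p})"
    by (intro span_neg span_sum span_scale span_base) auto
  finally have "inverse (lead_coeff p) *\<^sub>R lead_coeff p *\<^sub>R power_of x (degree p) \<in>
      span (power_of x ` {..<degree p})"
    by (rule span_scale)
  then show "power_of x (degree p) \<in> span (power_of x ` {..<degree p})"
    using assms(1) by simp
qed

text \<open>The product of the linear factors for the eigenvalues of \<open>x\<close> on a
  diagonalising frame \<open>G\<close> annihilates \<open>x\<close>, and \<open>G\<close> has the
  cardinality of \<open>F\<close>.\<close>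

lemma jdegree_le_frame_card:
  assumes "frame F"
  shows "jdegree (\<odot>) e x \<le> card F"
proof -
  obtain G where G: "frame G" "\<forall>c\<in>G. \<exists>r. x \<odot> c = r *\<^sub>R c" using frame_exists by blast
  then obtain h where "\<And>c. c \<in> G \<Longrightarrow> x \<odot> c = h c *\<^sub>R c" by metis
  then have x: "x = (\<Sum>c\<in>G. h c *\<^sub>R c)"
    using frame_system[OF G(1)] by (intro idempotent_system_expand)
  let ?p = "\<Prod>c\<in>G. [:- h c, 1:]"
  have "jpoly x ?p = (\<Sum>c\<in>G. poly ?p (h c) *\<^sub>R c)"
    unfolding x by (rule jpoly_expansion[OF frame_system[OF G(1)]])
  also have "\<dots> = 0"
    using frame_finite[OF G(1)] by (intro sum.neutral) (auto simp: poly_prod)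
  finally have "jdegree (\<odot>) e x \<le> degree ?p"
    using frame_finite[OF G(1)] by (intro jdegree_le_annihilator) simp_all
  also have "\<dots> \<le> card G"
    using degree_prod_sum_le[OF frame_finite[OF G(1)], of "\<lambda>c. [:- h c, 1:]"]
    by (simp add: o_def)
  finally show ?thesis using frame_card_eq[OF assms G(1)] by simp
qed

text \<open>The upper bound is attained at an element with pairwise distinct coefficients on
  \<open>F\<close>: each of them is a root of any annihilating polynomial.\<close>

lemma frame_card_jdegree:
  assumes F: "frame F"
  shows "\<exists>x. jdegree (\<odot>) e x = card F"
proof -
  obtain f :: "'v \<Rightarrow> nat" where f: "inj_on f F"
    using finite_imp_inj_to_nat_seg[OF frame_finite[OF F]] by blast
  define h where "h c = real (f c)" for c
  have inj: "inj_on h F" using f by (auto simp: h_def inj_on_def)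
  let ?x = "\<Sum>c\<in>F. h c *\<^sub>R c"
  obtain p where p: "p \<noteq> 0" "degree p \<le> jdegree (\<odot>) e ?x" "jpoly ?x p = 0"
    using jdegree_span by (rule power_span_annihilator)
  have "poly p (h c) = 0" if c: "c \<in> F" for c
  proof -
    have "(\<Sum>c\<in>F. poly p (h c) *\<^sub>R c) \<odot> c = 0"
      using p(3) unfolding jpoly_expansion[OF frame_system[OF F]] by (simp add: jp_zero_left)
    then have "poly p (h c) *\<^sub>R c = 0"
      using idempotent_system_jp[OF frame_system[OF F] c] by simp
    then show ?thesis
      using primitive_idempotent_nonzero[OF frame_primitive[OF F c]] by simp
  qed
  then have "card (h ` F) \<le> card {t. poly p t = 0}"
    using p(1) by (intro card_mono poly_roots_finite) auto
  also have "\<dots> \<le> degree p" by (rule card_poly_roots_bound[OF p(1)])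
  finally have "card F \<le> jdegree (\<odot>) e ?x" using p(2) card_image[OF inj] by simp
  then show ?thesis using jdegree_le_frame_card[OF F, of ?x] by (intro exI[of _ ?x]) simp
qed

lemma jrank_eq_frame_card:
  assumes F: "frame F"
  shows "jrank (\<odot>) e = card F"
  unfolding jrank_def
proof (rule Max_eqI)
  show "finite (range (jdegree (\<odot>) e))"
    using jdegree_le_frame_card[OF F] by (intro finite_subset[OF _ finite_atMost[of "card F"]]) auto
  show "card F \<in> range (jdegree (\<odot>) e)" using frame_card_jdegree[OF F] by (metis rangeI)
qed (use jdegree_le_frame_card[OF F] in auto)

section \<open>Jordan frames as indexed families\<close>

lemma jordan_frame_frame:
  fixes c :: "'n::finite \<Rightarrow> 'v"
  assumes "jordan_frame (\<odot>) e c"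
  shows "inj c" "frame (range c)"
proof -
  have prim: "primitive_idempotent (\<odot>) (c i)" and orth: "i \<noteq> j \<Longrightarrow> c i \<odot> c j = 0"
    and total: "(\<Sum>i\<in>UNIV. c i) = e" for i j
    using assms by (auto simp: jordan_frame_def)
  have idem: "c i \<odot> c i = c i" "c i \<noteq> 0" for i
    using prim primitive_idempotent_jp primitive_idempotent_nonzero by blast+
  show inj: "inj c"
  proof (rule injI, rule ccontr)
    fix i j assume "c i = c j" "i \<noteq> j"
    then show False using orth[of i j] idem[of i] by simp
  qed
  have "\<Sum>(range c) = e" using sum.reindex[OF inj, of "\<lambda>x. x"] total by simp
  moreover have "u \<odot> v = 0" if "u \<in> range c" "v \<in> range c" "u \<noteq> v" for u v
    using that orth by force
  ultimately show "frame (range c)"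
    unfolding frame_def idempotent_system_def using prim idem by auto
qed

lemma sum_frame_reindex:
  assumes "inj c"
  shows "(\<Sum>i\<in>UNIV. v i *\<^sub>R c i) = (\<Sum>d\<in>range c. v (inv c d) *\<^sub>R d)"
  using assms by (simp add: sum.reindex)

lemma frame_trace_jordan_frame:
  fixes c :: "'n::finite \<Rightarrow> 'v"
  assumes F: "frame F" and c: "jordan_frame (\<odot>) e c"
  shows "frame_trace F (\<Sum>i\<in>UNIV. v i *\<^sub>R c i) = (\<Sum>i\<in>UNIV. v i)"
proof -
  have inj: "inj c" using c by (rule jordan_frame_frame)
  have "frame_trace F (\<Sum>i\<in>UNIV. v i *\<^sub>R c i) = (\<Sum>d\<in>range c. v (inv c d))"
    unfolding sum_frame_reindex[OF inj]
    by (rule frame_trace_expansion[OF F jordan_frame_frame(2)[OF c]])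
  also have "\<dots> = (\<Sum>i\<in>UNIV. v i)"
    using inj by (simp add: sum.reindex)
  finally show ?thesis .
qed

lemma jpoly_jordan_frame:
  fixes c :: "'n::finite \<Rightarrow> 'v"
  assumes c: "jordan_frame (\<odot>) e c"
  shows "jpoly (\<Sum>i\<in>UNIV. v i *\<^sub>R c i) p = (\<Sum>i\<in>UNIV. poly p (v i) *\<^sub>R c i)"
  unfolding sum_frame_reindex[OF jordan_frame_frame(1)[OF c]]
  by (rule jpoly_expansion[OF frame_system[OF jordan_frame_frame(2)[OF c]]])

lemma jordan_frame_square:
  fixes c :: "'n::finite \<Rightarrow> 'v"
  assumes c: "jordan_frame (\<odot>) e c"
  shows "(\<Sum>i\<in>UNIV. v i *\<^sub>R c i) \<odot> (\<Sum>i\<in>UNIV. v i *\<^sub>R c i) = (\<Sum>i\<in>UNIV. (v i)\<^sup>2 *\<^sub>R c i)"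
  using jpoly_jordan_frame[OF c, of v "[:0, 0, 1:]"]
  by (simp add: jpoly_pCons jp_zero_right unit_right power2_eq_square)

lemma jordan_frame_reindex:
  fixes c :: "'n::finite \<Rightarrow> 'v"
  assumes c: "jordan_frame (\<odot>) e c" and p: "bij p"
  shows "jordan_frame (\<odot>) e (c \<circ> p)"
proof -
  have "(\<Sum>i\<in>UNIV. c (p i)) = (\<Sum>i\<in>UNIV. c i)"
    using p by (rule sum.reindex_bij_betw)
  then show ?thesis
    using c bij_is_inj[OF p] by (auto simp: jordan_frame_def inj_eq)
qed

text \<open>The rank hypothesis gives a diagonalising frame the cardinality of \<open>'n\<close>, so
  that a bijection can index it.\<close>

lemma jordan_frame_expansion_exists:
  assumes "jrank (\<odot>) e = CARD('n::finite)"
  shows "\<exists>(c :: 'n \<Rightarrow> 'v) v. jordan_frame (\<odot>) e c \<and> x = (\<Sum>i\<in>UNIV. v i *\<^sub>R c i)"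
proof -
  obtain F where F: "frame F" "\<forall>c\<in>F. \<exists>r. x \<odot> c = r *\<^sub>R c" using frame_exists by blast
  then obtain h where "\<And>c. c \<in> F \<Longrightarrow> x \<odot> c = h c *\<^sub>R c" by metis
  then have x: "x = (\<Sum>c\<in>F. h c *\<^sub>R c)"
    using frame_system[OF F(1)] by (intro idempotent_system_expand)
  have "card F = CARD('n)" using jrank_eq_frame_card[OF F(1)] assms by simp
  then obtain c :: "'n \<Rightarrow> 'v" where c: "bij_betw c UNIV F"
    using finite_same_card_bij[of "UNIV :: 'n set" F] frame_finite[OF F(1)] by auto
  then have cF: "c i \<in> F" and inj: "c i = c j \<longleftrightarrow> i = j" for i j
    by (auto simp: bij_betw_def inj_eq)
  have "(\<Sum>i\<in>UNIV. c i) = e"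
    using sum.reindex_bij_betw[OF c, of "\<lambda>x. x"] frame_sum[OF F(1)] by simp
  then have "jordan_frame (\<odot>) e c"
    using F(1) cF inj by (auto simp: jordan_frame_def frame_def idempotent_system_def)
  moreover have "x = (\<Sum>i\<in>UNIV. h (c i) *\<^sub>R c i)"
    using sum.reindex_bij_betw[OF c, of "\<lambda>c. h c *\<^sub>R c"] x by simp
  ultimately show ?thesis by (intro exI[of _ c] exI[of _ "\<lambda>i. h (c i)"] conjI)
qed

end

section \<open>The eigenvalue map\<close>

lemma antimono_rearrangement_exists:
  fixes f :: "'n::{finite,linorder} \<Rightarrow> real"
  shows "\<exists>p :: 'n \<Rightarrow> 'n. bij p \<and> antimono (f \<circ> p)"
proof -
  define us where "us = sorted_list_of_set (UNIV :: 'n set)"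
  \<comment> \<open>The sign of the key turns ascending order into decreasing order of
    \<open>f\<close>. Below, \<open>ix i\<close> is the position of \<open>i\<close> in the
    increasing enumeration \<open>us\<close>, and the rearrangement sends \<open>i\<close> to the
    entry of \<open>xs\<close> at that position.\<close>
  define xs where "xs = sort_key (\<lambda>i. - f i) us"
  define n where "n = length us"
  have us: "sorted us" "distinct us" "set us = UNIV" by (simp_all add: us_def)
  have len: "length xs = n" by (simp add: xs_def n_def)
  have bij_us: "bij_betw ((!) us) {..<n} UNIV"
    using us by (intro bij_betw_nth) (auto simp: n_def)
  have bij_xs: "bij_betw ((!) xs) {..<n} UNIV"
    using us by (intro bij_betw_nth) (auto simp: xs_def n_def)
  define ix where "ix = inv_into {..<n} ((!) us)"
  have ix: "bij_betw ix UNIV {..<n}" unfolding ix_def by (rule bij_betw_inv_into[OF bij_us])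
  have us_ix: "us ! ix i = i" for i
    unfolding ix_def using bij_us by (simp add: bij_betw_def f_inv_into_f)
  have ix_lt: "ix i < n" for i using ix by (auto simp: bij_betw_def)
  have "antimono (f \<circ> ((!) xs \<circ> ix))"
  proof (rule antimonoI)
    fix i j :: 'n assume "i \<le> j"
    have "ix i \<le> ix j"
    proof (rule ccontr)
      assume "\<not> ix i \<le> ix j"
      then have "ix j < ix i" by simp
      then have "us ! ix j \<le> us ! ix i"
        using us(1) ix_lt by (intro sorted_nth_mono) (auto simp: n_def)
      then have "i = j" using us_ix \<open>i \<le> j\<close> by simp
      then show False using \<open>ix j < ix i\<close> by simp
    qed
    then have "map (\<lambda>i. - f i) xs ! ix i \<le> map (\<lambda>i. - f i) xs ! ix j"
      using ix_lt len by (intro sorted_nth_mono) (simp_all add: xs_def)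
    then show "(f \<circ> ((!) xs \<circ> ix)) j \<le> (f \<circ> ((!) xs \<circ> ix)) i"
      using ix_lt len by simp
  qed
  moreover have "bij ((!) xs \<circ> ix)" using ix bij_xs by (rule bij_betw_trans)
  ultimately show ?thesis by (intro exI[of _ "(!) xs \<circ> ix"] conjI)
qed

text \<open>Superlevel sets of antimonotone functions on a linear order are initial segments, hence
  nested, and nested finite sets of equal cardinality coincide. The superlevel sets determine the
  function.\<close>

lemma antimono_eqI:
  fixes f g :: "'n::{finite,linorder} \<Rightarrow> real"
  assumes "antimono f" "antimono g" "\<And>t. card {i. t \<le> f i} = card {i. t \<le> g i}"
  shows "f = g"
proof -
  have "{i. t \<le> f i} = {i. t \<le> g i}" for t
  proof -
    have "{i. t \<le> f i} \<subseteq> {i. t \<le> g i} \<or> {i. t \<le> g i} \<subseteq> {i. t \<le> f i}"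
    proof (rule ccontr)
      assume "\<not> ?thesis"
      then obtain i j where "t \<le> f i" "\<not> t \<le> g i" "t \<le> g j" "\<not> t \<le> f j" by blast
      then show False
        using antimonoD[OF assms(1), of i j] antimonoD[OF assms(1), of j i]
          antimonoD[OF assms(2), of i j] antimonoD[OF assms(2), of j i] linear[of i j] by force
    qed
    then show ?thesis using assms(3)[of t] by (metis card_subset_eq finite)
  qed
  then have "t \<le> f i \<longleftrightarrow> t \<le> g i" for t i by blast
  then show ?thesis by (intro ext order.antisym) (metis order.refl)+
qed

context euclidean_jordan_algebra
begin

text \<open>The number of coefficients that are at least \<open>t\<close> is the trace of
  \<open>jpoly x p\<close>, where \<open>x\<close> is the common value of the two sums and
  \<open>p\<close> interpolates the indicator of that condition on all coefficients. The same
  functional \<open>?tr\<close> evaluates both expansions.\<close>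

lemma eigenvalues_unique:
  fixes c d :: "'n::{finite,linorder} \<Rightarrow> 'v"
  assumes c: "jordan_frame (\<odot>) e c" and d: "jordan_frame (\<odot>) e d"
    and eq: "(\<Sum>i\<in>UNIV. v i *\<^sub>R c i) = (\<Sum>i\<in>UNIV. w i *\<^sub>R d i)"
    and anti: "antimono v" "antimono w"
  shows "v = w"
proof (rule antimono_eqI[OF anti])
  fix t
  obtain p where p: "\<And>s. s \<in> range v \<union> range w \<Longrightarrow> poly p s = (if t \<le> s then 1 else 0)"
    using interpolation_poly[of "range v \<union> range w" "\<lambda>s. if t \<le> s then 1 else 0"] by auto
  let ?tr = "frame_trace (range c)"
  have "(\<Sum>i\<in>UNIV. poly p (v i)) = ?tr (jpoly (\<Sum>i\<in>UNIV. v i *\<^sub>R c i) p)"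
    unfolding jpoly_jordan_frame[OF c]
    by (rule frame_trace_jordan_frame[OF jordan_frame_frame(2)[OF c] c, symmetric])
  also have "\<dots> = (\<Sum>i\<in>UNIV. poly p (w i))"
    unfolding eq jpoly_jordan_frame[OF d]
    by (rule frame_trace_jordan_frame[OF jordan_frame_frame(2)[OF c] d])
  finally have "(\<Sum>i\<in>UNIV. if t \<le> v i then 1 else 0 :: real) =
      (\<Sum>i\<in>UNIV. if t \<le> w i then 1 else 0)"
    by (simp add: p)
  then show "card {i. t \<le> v i} = card {i. t \<le> w i}"
    by (simp flip: sum.inter_filter)
qed

lemma eigenvalue_map_eqI:
  fixes c :: "'n::{finite,linorder} \<Rightarrow> 'v"
  assumes c: "jordan_frame (\<odot>) e c" and "antimono v"
  shows "eigenvalue_map (\<odot>) e (\<Sum>i\<in>UNIV. v i *\<^sub>R c i) = (\<chi> i. v i)"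
  unfolding eigenvalue_map_def
proof (rule the_equality)
  fix u :: "(real, 'n) vec"
  assume u: "antimono (\<lambda>i. u $ i) \<and> (\<exists>d. jordan_frame (\<odot>) e d \<and>
     (\<Sum>i\<in>UNIV. v i *\<^sub>R c i) = (\<Sum>i\<in>UNIV. (u $ i) *\<^sub>R d i))"
  then have "v = (\<lambda>i. u $ i)" using eigenvalues_unique[OF c] assms(2) by blast
  then show "u = (\<chi> i. v i)" by (simp add: vec_eq_iff)
next
  have "(\<lambda>i. (\<chi> i. v i) $ i) = v" by (rule ext) simp
  then show "antimono (\<lambda>i. (\<chi> i. v i) $ i) \<and> (\<exists>d. jordan_frame (\<odot>) e d \<and>
     (\<Sum>i\<in>UNIV. v i *\<^sub>R c i) = (\<Sum>i\<in>UNIV. ((\<chi> i. v i) $ i) *\<^sub>R d i))"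
    using assms by auto
qed

lemma eigenvalue_map_rearrangement:
  fixes c :: "'n::{finite,linorder} \<Rightarrow> 'v"
  assumes c: "jordan_frame (\<odot>) e c"
  shows "\<exists>p :: 'n \<Rightarrow> 'n. bij p \<and> eigenvalue_map (\<odot>) e (\<Sum>i\<in>UNIV. v i *\<^sub>R c i) = (\<chi> i. v (p i))"
proof -
  obtain p :: "'n \<Rightarrow> 'n" where p: "bij p" "antimono (v \<circ> p)" using antimono_rearrangement_exists by blast
  have "(\<Sum>i\<in>UNIV. v (p i) *\<^sub>R c (p i)) = (\<Sum>i\<in>UNIV. v i *\<^sub>R c i)"
    using p(1) by (rule sum.reindex_bij_betw)
  then have "eigenvalue_map (\<odot>) e (\<Sum>i\<in>UNIV. v i *\<^sub>R c i) = (\<chi> i. v (p i))"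
    using eigenvalue_map_eqI[OF jordan_frame_reindex[OF c p(1)] p(2)] by simp
  then show ?thesis using p(1) by (intro exI[of _ p] conjI)
qed

lemma jtrace_eq:
  fixes c :: "'n::{finite,linorder} \<Rightarrow> 'v"
  assumes c: "jordan_frame (\<odot>) e c"
  shows "jtrace TYPE('n) (\<odot>) e (\<Sum>i\<in>UNIV. v i *\<^sub>R c i) = (\<Sum>i\<in>UNIV. v i)"
proof -
  obtain p :: "'n \<Rightarrow> 'n" where p: "bij p" "eigenvalue_map (\<odot>) e (\<Sum>i\<in>UNIV. v i *\<^sub>R c i) = (\<chi> i. v (p i))"
    using eigenvalue_map_rearrangement[OF c] by blast
  have "(\<Sum>i\<in>UNIV. v (p i)) = (\<Sum>i\<in>UNIV. v i)" using p(1) by (rule sum.reindex_bij_betw)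
  then show ?thesis by (simp add: jtrace_def p(2))
qed

text \<open>Two elements and their sum may have no common diagonalising frame, so additivity is not
  visible from eigenvalues. It comes from the identification with \<open>frame_trace F\<close> for
  one fixed \<open>F\<close>.\<close>

lemma linear_jtrace:
  assumes "jrank (\<odot>) e = CARD('n::{finite,linorder})"
  shows "linear (jtrace TYPE('n) (\<odot>) e)"
proof -
  obtain F where F: "frame F" using frame_exists by blast
  have "jtrace TYPE('n) (\<odot>) e x = frame_trace F x" for x
  proof -
    obtain c :: "'n \<Rightarrow> 'v" and v where c: "jordan_frame (\<odot>) e c" "x = (\<Sum>i\<in>UNIV. v i *\<^sub>R c i)"
      using jordan_frame_expansion_exists[OF assms] by blast
    show ?thesis unfolding c(2) jtrace_eq[OF c(1)] frame_trace_jordan_frame[OF F c(1)] ..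
  qed
  then have "jtrace TYPE('n) (\<odot>) e = frame_trace F" by blast
  then show ?thesis using linear_frame_trace by simp
qed

text \<open>Squaring a diagonalised root squares its coefficients; conversely, square roots of
  nonnegative coefficients on the same frame give a root.\<close>

lemma symmetric_cone_iff:
  assumes "jrank (\<odot>) e = CARD('n::{finite,linorder})"
  shows "x \<in> symmetric_cone (\<odot>) \<longleftrightarrow> (\<exists>(c :: 'n \<Rightarrow> 'v) v. jordan_frame (\<odot>) e c \<and>
    (\<forall>i. 0 \<le> v i) \<and> x = (\<Sum>i\<in>UNIV. v i *\<^sub>R c i))"
proof
  assume "x \<in> symmetric_cone (\<odot>)"
  then obtain y where x: "x = y \<odot> y" by (auto simp: symmetric_cone_def)
  obtain c :: "'n \<Rightarrow> 'v" and v where c: "jordan_frame (\<odot>) e c" "y = (\<Sum>i\<in>UNIV. v i *\<^sub>R c i)"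
    using jordan_frame_expansion_exists[OF assms] by blast
  have "x = (\<Sum>i\<in>UNIV. (v i)\<^sup>2 *\<^sub>R c i)"
    unfolding x c(2) by (rule jordan_frame_square[OF c(1)])
  then show "\<exists>(c :: 'n \<Rightarrow> 'v) v. jordan_frame (\<odot>) e c \<and>
    (\<forall>i. 0 \<le> v i) \<and> x = (\<Sum>i\<in>UNIV. v i *\<^sub>R c i)"
    using c(1) by (intro exI[of _ c] exI[of _ "\<lambda>i. (v i)\<^sup>2"]) simp
next
  assume "\<exists>(c :: 'n \<Rightarrow> 'v) v. jordan_frame (\<odot>) e c \<and>
    (\<forall>i. 0 \<le> v i) \<and> x = (\<Sum>i\<in>UNIV. v i *\<^sub>R c i)"
  then obtain c :: "'n \<Rightarrow> 'v" and v where c: "jordan_frame (\<odot>) e c"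
    and v: "\<And>i. 0 \<le> v i" "x = (\<Sum>i\<in>UNIV. v i *\<^sub>R c i)" by blast
  have "x = (\<Sum>i\<in>UNIV. sqrt (v i) *\<^sub>R c i) \<odot> (\<Sum>i\<in>UNIV. sqrt (v i) *\<^sub>R c i)"
    unfolding jordan_frame_square[OF c] using v by simp
  then show "x \<in> symmetric_cone (\<odot>)" by (auto simp: symmetric_cone_def)
qed

end

section \<open>Permutation invariance, the matrix \<open>A\<close> and the cone identity\<close>

lemma permutation_invariant_rearrange:
  fixes Q :: "(real ^ 'n::finite) set"
  assumes "permutation_invariant Q" "bij p"
  shows "(\<chi> i. v (p i)) \<in> Q \<longleftrightarrow> (\<chi> i. v i) \<in> Q"
proof -
  have closed: "(\<chi> i. w (q i)) \<in> Q" if "(\<chi> i. w i) \<in> Q" "bij q" for w :: "'n \<Rightarrow> real" and q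
  proof -
    let ?P = "(\<chi> i j. if j = q i then 1 else 0) :: real ^ 'n ^ 'n"
    have inv: "(\<lambda>x. ?P *v x) ` Q = Q"
      using assms(1) that(2) by (auto simp: permutation_invariant_def permutation_matrix_def)
    have "?P *v (\<chi> i. w i) \<in> (\<lambda>x. ?P *v x) ` Q" using that(1) by (rule imageI)
    moreover have "?P *v (\<chi> i. w i) = (\<chi> i. w (q i))"
      by (simp add: matrix_vector_mult_def if_distrib[of "\<lambda>a. a * _"] cong: if_cong)
    ultimately show ?thesis unfolding inv by simp
  qed
  have "(\<chi> i. v i) \<in> Q" if "(\<chi> i. v (p i)) \<in> Q"
    using closed[OF that bij_imp_bij_inv[OF assms(2)]] assms(2)
    by (simp add: bij_is_surj surj_f_inv_f)
  then show ?thesis using closed assms(2) by blast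
qed

lemma scaled_ones_matrix_vector:
  "(((a - b) *\<^sub>R mat 1 + b *\<^sub>R all_ones) *v u) $ i = (a - b) * u $ i + b * (\<Sum>j\<in>UNIV. u $ j)"
  for u :: "real ^ 'n::finite"
proof -
  have "(all_ones *v u) $ i = (\<Sum>j\<in>UNIV. u $ j)"
    by (simp add: all_ones_def matrix_vector_mult_def)
  then show ?thesis
    by (simp add: matrix_vector_mult_add_rdistrib scaleR_matrix_vector_assoc[symmetric])
qed

theorem proposition5p1:
  fixes jp :: "'v::euclidean_space \<Rightarrow> 'v \<Rightarrow> 'v" and e :: 'v
    and Q :: "(real ^ 'n::{finite,linorder}) set"
    and A :: "real ^ 'n::{finite,linorder} ^ 'n::{finite,linorder}" and a b :: real and L :: "'v \<Rightarrow> 'v"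
  assumes "euclidean_jordan_algebra jp e"
    and "jrank jp e = CARD('n)"
    and "permutation_invariant Q" and "proper_cone Q" and "polyhedral_cone Q"
    and "reducible_cone Q"
    and "A = (a - b) *\<^sub>R mat 1 + b *\<^sub>R all_ones"
    and "a \<noteq> b" and "a \<noteq> (1 - real CARD('n)) * b"
    and "Q = (\<lambda>u. A *v u) ` nonneg_orthant"
    and "L = (\<lambda>x. (a - b) *\<^sub>R x + (b * jtrace TYPE('n) jp e x) *\<^sub>R e)"
  shows "isomorphic_cones (spectral_cone jp e Q) (symmetric_cone jp) \<and>
    linear L \<and> bij L \<and>
    spectral_cone jp e Q = L ` symmetric_cone jp"
proof -
  interpret euclidean_jordan_algebra jp e by (rule assms(1))
  note rank = assms(2)
  let ?n = "real CARD('n)"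
  let ?tr = "jtrace TYPE('n) jp e"
  have lin_tr: "linear ?tr" using rank by (rule linear_jtrace)
  have "linear L"
    unfolding assms(11)
    by (rule linearI) (simp_all add: linear_add[OF lin_tr] linear_cmul[OF lin_tr] algebra_simps)
  have L_frame: "L (\<Sum>i\<in>UNIV. v i *\<^sub>R c i) =
      (\<Sum>i\<in>UNIV. ((a - b) * v i + b * (\<Sum>j\<in>UNIV. v j)) *\<^sub>R c i)"
    if c: "jordan_frame jp e c" for c :: "'n \<Rightarrow> 'v" and v
  proof -
    have "e = (\<Sum>i\<in>UNIV. c i)" using c by (simp add: jordan_frame_def)
    then show ?thesis
      unfolding assms(11) jtrace_eq[OF c]
      by (simp add: scaleR_sum_right scaleR_add_left sum.distrib)
  qed
  have "inj L"
    unfolding linear_injective_0[OF \<open>linear L\<close>]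
  proof (intro allI impI)
    fix x assume "L x = 0"
    obtain c :: "'n \<Rightarrow> 'v" where "jordan_frame jp e c"
      using jordan_frame_expansion_exists[OF rank] by blast
    then have "?tr e = ?n" using jtrace_eq[of c "\<lambda>_. 1"] by (simp add: jordan_frame_def)
    \<comment> \<open>Taking traces isolates a scalar equation: its factor is nonzero by one
      condition on \<open>a\<close> and \<open>b\<close>, so the trace of \<open>x\<close> vanishes.
      Then \<open>L x\<close> is \<open>(a - b)\<close> times \<open>x\<close>, and the other
      condition applies.\<close>
    then have "?tr (L x) = (a - (1 - ?n) * b) * ?tr x"
      unfolding assms(11)
      by (simp add: linear_add[OF lin_tr] linear_diff[OF lin_tr] linear_cmul[OF lin_tr] algebra_simps)
    then have "?tr x = 0" using assms(9) \<open>L x = 0\<close> linear_0[OF lin_tr] by simp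
    then show "x = 0" using \<open>L x = 0\<close> assms(8) unfolding assms(11) by simp
  qed
  then have "bij L"
    using \<open>linear L\<close> linear_injective_imp_surjective by (auto simp: bij_def)
  \<comment> \<open>Permutation invariance of \<open>Q\<close> allows the coefficients to be tested
    in the order of any frame instead of decreasing order.\<close>
  have spectral_iff: "(\<Sum>i\<in>UNIV. v i *\<^sub>R c i) \<in> spectral_cone jp e Q \<longleftrightarrow> (\<chi> i. v i) \<in> Q"
    if "jordan_frame jp e c" for c :: "'n \<Rightarrow> 'v" and v
    using eigenvalue_map_rearrangement[OF that, of v] permutation_invariant_rearrange[OF assms(3)]
    by (auto simp: spectral_cone_def)
  have A: "A *v u = (\<chi> i. (a - b) * u $ i + b * (\<Sum>j\<in>UNIV. u $ j))" for u
    by (simp add: assms(7) scaled_ones_matrix_vector vec_eq_iff)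
  have cone: "spectral_cone jp e Q = L ` symmetric_cone jp"
  proof (intro subset_antisym subsetI)
    fix x assume x: "x \<in> spectral_cone jp e Q"
    obtain c :: "'n \<Rightarrow> 'v" and v where c: "jordan_frame jp e c" "x = (\<Sum>i\<in>UNIV. v i *\<^sub>R c i)"
      using jordan_frame_expansion_exists[OF rank] by blast
    then have "(\<chi> i. v i) \<in> Q" using x spectral_iff by simp
    then obtain u where u: "u \<in> nonneg_orthant" "(\<chi> i. v i) = A *v u"
      unfolding assms(10) by blast
    then have "v i = (a - b) * u $ i + b * (\<Sum>j\<in>UNIV. u $ j)" for i
      by (simp add: A vec_eq_iff)
    then have "x = L (\<Sum>i\<in>UNIV. (u $ i) *\<^sub>R c i)"
      using L_frame[OF c(1), of "\<lambda>i. u $ i"] c(2) by simp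
    moreover have "(\<Sum>i\<in>UNIV. (u $ i) *\<^sub>R c i) \<in> symmetric_cone jp"
      unfolding symmetric_cone_iff[OF rank] using c(1) u(1)
      by (intro exI[of _ c] exI[of _ "\<lambda>i. u $ i"]) (simp add: nonneg_orthant_def)
    ultimately show "x \<in> L ` symmetric_cone jp" by blast
  next
    fix x assume "x \<in> L ` symmetric_cone jp"
    then obtain y where y: "y \<in> symmetric_cone jp" "x = L y" by blast
    then obtain c :: "'n \<Rightarrow> 'v" and v where c: "jordan_frame jp e c" "\<forall>i. 0 \<le> v i"
      "y = (\<Sum>i\<in>UNIV. v i *\<^sub>R c i)"
      using symmetric_cone_iff[OF rank] by blast
    have "A *v (\<chi> i. v i) \<in> Q"
      unfolding assms(10) using c(2) by (intro imageI) (simp add: nonneg_orthant_def)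
    then show "x \<in> spectral_cone jp e Q"
      unfolding y(2) c(3) L_frame[OF c(1)] spectral_iff[OF c(1)] by (simp add: A)
  qed
  \<comment> \<open>The required isomorphism maps the spectral cone to the symmetric cone, so it is
    the inverse of \<open>L\<close>.\<close>
  obtain M where M: "linear M" "\<And>x. M (L x) = x" "\<And>x. L (M x) = x"
    using linear_injective_isomorphism[OF \<open>linear L\<close> \<open>inj L\<close>] by blast
  have "bij M" using M(2,3) by (metis bijI')
  moreover have "M ` spectral_cone jp e Q = symmetric_cone jp"
    unfolding cone image_image by (simp add: M(2))
  ultimately have "isomorphic_cones (spectral_cone jp e Q) (symmetric_cone jp)"
    unfolding isomorphic_cones_def using M(1) by blast
  then show ?thesis using \<open>linear L\<close> \<open>bij L\<close> cone by blast
qed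

end
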